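(* Let $\rho$ be a probability density on $\mathbb{R}^d$ satisfying Assumption A1 and let $h$ satisfy Assumption A2 (both stated in the context). Let $\phi\in H^1_0$ be the weak solution of the Poisson equation $-\Delta_\rho\phi=h$, let $0=\lambda_0<\lambda_1\le\lambda_2\le\cdots$ be the eigenvalues of $-\Delta_\rho$, and let $\{e_m\}_{m\ge 0}$, $e_0=1$, be the associated eigenfunctions forming an orthonormal basis of $L^2(\mathbb{R}^d,\mu)$. Let $X^1,X^2,\dots$ be i.i.d. samples from $\mu$. Fix $M<\infty$, $M\ge 1$, and use the basis functions $\psi_m=e_m$, $m=1,\dots,M$. For $N\ge 1$ let $A^{(N)}\in\mathbb{R}^{M\times M}$ and $b^{(N)}\in\mathbb{R}^M$ be $$A^{(N)}_{ml}=\frac1N\sum_{i=1}^N\nabla e_l(X^i)\cdot\nabla e_m(X^i),\qquad b^{(N)}_m=\frac1N\sum_{i=1}^N h(X^i)e_m(X^i).$$ Then the probability that the matrix equation $A^{(N)}c^{(N)}=b^{(N)}$ has a solution $c^{(N)}\in\mathbb{R}^M$ tends to $1$ as $N\to\infty$. Moreover, writing $\phi^{(M,N)}(x)=\sum_{m=1}^M c^{(N)}_m e_m(x)$ for the resulting empirical Galerkin approximation (with $c^{(N)}$ a measurably chosen solution whenever one exists), there is a sequence of random variables $\{\epsilon_N\}$ with $\epsilon_N\to 0$ almost surely as $N\to\infty$ such that, whenever the solution exists, $$\|\phi^{(M,N)}-\phi\|_2\le\frac{1}{\lambda_M}\|h\|_2+\epsilon_N .$$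
   Context: $\mu$ is the probability measure on $\mathbb{R}^d$ with density $\rho$. $L^2=L^2(\mathbb{R}^d,\mu)$ has inner product $\langle\phi,\psi\rangle=\int\phi\psi\,d\mu$ and norm $\|\cdot\|_2$. $H^1$ is the space of functions in $L^2$ whose weak derivatives are in $L^2$; $L^2_0=\{\phi\in L^2:\int\phi\,d\mu=0\}$ and $H^1_0=\{\phi\in H^1:\int\phi\,d\mu=0\}$. Weighted Laplacian: $\Delta_\rho\phi=\frac1\rho\nabla\cdot(\rho\nabla\phi)$. Assumption A1: $\rho(x)=e^{-(x-\bar m)^T\Sigma^{-1}(x-\bar m)-V(x)}$ with $\bar m\in\mathbb{R}^d$, $\Sigma$ a positive-definite matrix, $V\in C^2$, and $V,DV,D^2V\in L^\infty$. Assumption A2: $h\in L^2$ and $\int h\,d\mu=0$. Under A1 the following facts are known: $-\Delta_\rho$ has discrete spectrum $0=\lambda_0<\lambda_1\le\lambda_2\le\cdots$ with eigenfunctions forming a complete orthonormal basis of $L^2$. Under A1 and A2 there is a unique weak solution, i.e. a unique $\phi\in H^1_0$ with $\langle\nabla\phi,\nabla\psi\rangle=\langle h,\psi\rangle$ for all $\psi\in H^1_0$, where $\langle\nabla\phi,\nabla\psi\rangle=\int\nabla\phi\cdot\nabla\psi\,d\mu$. *)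

theory Defs
  imports "HOL-Probability.Probability"
begin

definition partial_deriv :: "'d \<Rightarrow> (real ^ 'd \<Rightarrow> real) \<Rightarrow> real ^ 'd::finite \<Rightarrow> real" where
  "partial_deriv i f x = frechet_derivative f (at x) (axis i 1)"

primrec C_k :: "nat \<Rightarrow> (real ^ 'd::finite \<Rightarrow> real) \<Rightarrow> bool" where
  "C_k 0 f \<longleftrightarrow> continuous_on UNIV f"
| "C_k (Suc k) f \<longleftrightarrow> (\<forall>x. f differentiable (at x)) \<and> (\<forall>i. C_k k (partial_deriv i f))"

definition test_function :: "(real ^ 'd::finite \<Rightarrow> real) \<Rightarrow> bool" where
  "test_function \<eta> \<longleftrightarrow> (\<forall>k. C_k k \<eta>) \<and> compact (closure {x. \<eta> x \<noteq> 0})"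

text \<open>
  Elements of \<open>L\<^sup>2(\<mu>)\<close> are represented by Borel functions, not by equivalence classes.
  \<open>L2_inner\<close> and \<open>L2_norm\<close> are meaningful only for arguments in \<open>L2 \<mu>\<close>, since the Bochner
  integral of a non-integrable function is \<open>0\<close>.
\<close>

definition L2 :: "'a measure \<Rightarrow> ('a \<Rightarrow> real) set" where
  "L2 \<mu> = {f \<in> borel_measurable \<mu>. integrable \<mu> (\<lambda>x. (f x)\<^sup>2)}"

definition L2_inner :: "'a measure \<Rightarrow> ('a \<Rightarrow> real) \<Rightarrow> ('a \<Rightarrow> real) \<Rightarrow> real" where
  "L2_inner \<mu> f g = (\<integral>x. f x * g x \<partial>\<mu>)"

definition L2_norm :: "'a measure \<Rightarrow> ('a \<Rightarrow> real) \<Rightarrow> real" where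
  "L2_norm \<mu> f = sqrt (L2_inner \<mu> f f)"

definition locally_integrable :: "(real ^ 'd::finite \<Rightarrow> real) \<Rightarrow> bool" where
  "locally_integrable f \<longleftrightarrow> (\<forall>K. compact K \<longrightarrow> set_integrable lborel K f)"

text \<open>
  Weak derivatives are taken in the usual sense of distributions, that is with respect to
  Lebesgue measure. They are determined only almost everywhere, so this is a relation:
  \<open>D\<close> is one version of the weak gradient of \<open>\<phi>\<close>.
\<close>

definition has_weak_gradient ::
  "(real ^ 'd::finite \<Rightarrow> real) \<Rightarrow> (real ^ 'd \<Rightarrow> real ^ 'd) \<Rightarrow> bool" where
  "has_weak_gradient \<phi> D \<longleftrightarrow>
     locally_integrable \<phi> \<and> (\<forall>i. locally_integrable (\<lambda>x. D x $ i)) \<and>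
     (\<forall>i \<eta>. test_function \<eta> \<longrightarrow>
        (\<integral>x. \<phi> x * partial_deriv i \<eta> x \<partial>lborel) = - (\<integral>x. D x $ i * \<eta> x \<partial>lborel))"

text \<open>
  \<open>H1 \<mu> \<phi> D\<close>: the function \<open>\<phi>\<close> belongs to \<open>H\<^sup>1\<close> and \<open>D\<close> is a version of its gradient;
  \<open>H1_0 \<mu> \<phi> D\<close> requires in addition that \<open>\<phi>\<close> has mean zero.
\<close>

definition H1 ::
  "(real ^ 'd::finite) measure \<Rightarrow> (real ^ 'd \<Rightarrow> real) \<Rightarrow> (real ^ 'd \<Rightarrow> real ^ 'd) \<Rightarrow> bool" where
  "H1 \<mu> \<phi> D \<longleftrightarrow> \<phi> \<in> L2 \<mu> \<and> has_weak_gradient \<phi> D \<and> (\<forall>i. (\<lambda>x. D x $ i) \<in> L2 \<mu>)"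

definition H1_0 ::
  "(real ^ 'd::finite) measure \<Rightarrow> (real ^ 'd \<Rightarrow> real) \<Rightarrow> (real ^ 'd \<Rightarrow> real ^ 'd) \<Rightarrow> bool" where
  "H1_0 \<mu> \<phi> D \<longleftrightarrow> H1 \<mu> \<phi> D \<and> (\<integral>x. \<phi> x \<partial>\<mu>) = 0"

definition grad_inner ::
  "(real ^ 'd::finite) measure \<Rightarrow> (real ^ 'd \<Rightarrow> real ^ 'd) \<Rightarrow> (real ^ 'd \<Rightarrow> real ^ 'd) \<Rightarrow> real" where
  "grad_inner \<mu> D E = (\<integral>x. D x \<bullet> E x \<partial>\<mu>)"

text \<open>
  \<open>\<Delta>\<^sub>\<rho> \<phi> = f\<close> for \<open>\<Delta>\<^sub>\<rho> \<phi> = \<rho>\<^sup>-\<^sup>1 \<nabla>\<cdot>(\<rho> \<nabla>\<phi>)\<close>, in weak form: multiply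
  \<open>\<nabla>\<cdot>(\<rho> \<nabla>\<phi>) = \<rho> f\<close> by \<open>\<psi> \<in> H\<^sup>1\<close> and integrate by parts, where \<open>d\<mu> = \<rho> dx\<close>. This is the
  self-adjoint operator on \<open>L\<^sup>2(\<mu>)\<close> associated with the form \<open>\<langle>\<nabla>\<phi>,\<nabla>\<psi>\<rangle>\<close> with domain \<open>H\<^sup>1\<close>.
\<close>

definition has_weighted_laplacian ::
  "(real ^ 'd::finite) measure \<Rightarrow> (real ^ 'd \<Rightarrow> real) \<Rightarrow> (real ^ 'd \<Rightarrow> real ^ 'd) \<Rightarrow>
   (real ^ 'd \<Rightarrow> real) \<Rightarrow> bool" where
  "has_weighted_laplacian \<mu> \<phi> D f \<longleftrightarrow>
     H1 \<mu> \<phi> D \<and> f \<in> L2 \<mu> \<and>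
     (\<forall>\<psi> E. H1 \<mu> \<psi> E \<longrightarrow> grad_inner \<mu> D E = - L2_inner \<mu> f \<psi>)"

definition neg_laplacian_eigenfunction ::
  "(real ^ 'd::finite) measure \<Rightarrow> real \<Rightarrow> (real ^ 'd \<Rightarrow> real) \<Rightarrow> (real ^ 'd \<Rightarrow> real ^ 'd) \<Rightarrow> bool" where
  "neg_laplacian_eigenfunction \<mu> l e D \<longleftrightarrow>
     \<not> (AE x in \<mu>. e x = 0) \<and> has_weighted_laplacian \<mu> e D (\<lambda>x. - (l * e x))"

definition poisson_weak_solution ::
  "(real ^ 'd::finite) measure \<Rightarrow> (real ^ 'd \<Rightarrow> real) \<Rightarrow> (real ^ 'd \<Rightarrow> real) \<Rightarrow>
   (real ^ 'd \<Rightarrow> real ^ 'd) \<Rightarrow> bool" where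
  "poisson_weak_solution \<mu> h \<phi> D \<longleftrightarrow>
     H1_0 \<mu> \<phi> D \<and> (\<forall>\<psi> E. H1_0 \<mu> \<psi> E \<longrightarrow> grad_inner \<mu> D E = L2_inner \<mu> h \<psi>)"

definition L2_orthonormal_basis :: "'a measure \<Rightarrow> (nat \<Rightarrow> 'a \<Rightarrow> real) \<Rightarrow> bool" where
  "L2_orthonormal_basis \<mu> e \<longleftrightarrow>
     (\<forall>m. e m \<in> L2 \<mu>) \<and>
     (\<forall>m l. L2_inner \<mu> (e m) (e l) = (if m = l then 1 else 0)) \<and>
     (\<forall>f \<in> L2 \<mu>. (\<lambda>n. L2_norm \<mu> (\<lambda>x. f x - (\<Sum>m<n. L2_inner \<mu> f (e m) * e m x))) \<longlonglongrightarrow> 0)"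

definition positive_definite :: "real ^ 'd ^ 'd::finite \<Rightarrow> bool" where
  "positive_definite S \<longleftrightarrow> transpose S = S \<and> (\<forall>x. x \<noteq> 0 \<longrightarrow> 0 < x \<bullet> (S *v x))"

text \<open>
  As \<open>V\<close> and its derivatives up to order two are continuous, membership in \<open>L\<^sup>\<infinity>\<close> is boundedness.
\<close>

definition assumption_A1 :: "(real ^ 'd::finite \<Rightarrow> real) \<Rightarrow> bool" where
  "assumption_A1 \<rho> \<longleftrightarrow>
     (\<exists>mbar S V. positive_definite S \<and> C_k 2 V \<and>
        bounded (range V) \<and>
        (\<forall>i. bounded (range (partial_deriv i V))) \<and>
        (\<forall>i j. bounded (range (partial_deriv i (partial_deriv j V)))) \<and>
        (\<forall>x. \<rho> x = exp (- ((x - mbar) \<bullet> (matrix_inv S *v (x - mbar))) - V x)))"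

definition assumption_A2 :: "'a measure \<Rightarrow> ('a \<Rightarrow> real) \<Rightarrow> bool" where
  "assumption_A2 \<mu> h \<longleftrightarrow> h \<in> L2 \<mu> \<and> (\<integral>x. h x \<partial>\<mu>) = 0"

text \<open>
  Matrices and vectors of size \<open>M\<close> are functions on \<open>nat\<close>, of which only the entries with
  indices in \<open>{1..M}\<close> matter. \<open>De m\<close> stands for the gradient of the basis function \<open>e m\<close>,
  and the samples are \<open>X 1, X 2, \<dots>\<close>.
\<close>

definition empirical_matrix ::
  "(nat \<Rightarrow> 'w \<Rightarrow> real ^ 'd::finite) \<Rightarrow> (nat \<Rightarrow> real ^ 'd \<Rightarrow> real ^ 'd) \<Rightarrow>
   nat \<Rightarrow> 'w \<Rightarrow> nat \<Rightarrow> nat \<Rightarrow> real" where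
  "empirical_matrix X De N \<omega> m l = (1 / real N) * (\<Sum>i=1..N. De l (X i \<omega>) \<bullet> De m (X i \<omega>))"

definition empirical_vector ::
  "(nat \<Rightarrow> 'w \<Rightarrow> real ^ 'd::finite) \<Rightarrow> (real ^ 'd \<Rightarrow> real) \<Rightarrow> (nat \<Rightarrow> real ^ 'd \<Rightarrow> real) \<Rightarrow>
   nat \<Rightarrow> 'w \<Rightarrow> nat \<Rightarrow> real" where
  "empirical_vector X h e N \<omega> m = (1 / real N) * (\<Sum>i=1..N. h (X i \<omega>) * e m (X i \<omega>))"

definition solves_system ::
  "nat \<Rightarrow> (nat \<Rightarrow> nat \<Rightarrow> real) \<Rightarrow> (nat \<Rightarrow> real) \<Rightarrow> (nat \<Rightarrow> real) \<Rightarrow> bool" where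
  "solves_system M A b c \<longleftrightarrow> (\<forall>m\<in>{1..M}. (\<Sum>l=1..M. A m l * c l) = b m)"

definition galerkin_approx ::
  "nat \<Rightarrow> (nat \<Rightarrow> 'a \<Rightarrow> real) \<Rightarrow> (nat \<Rightarrow> real) \<Rightarrow> 'a \<Rightarrow> real" where
  "galerkin_approx M e c x = (\<Sum>m=1..M. c m * e m x)"

end

theory Submission
  imports Defs "Jordan_Normal_Form.Determinant"
begin

text \<open>
  In the eigenbasis the Galerkin system is diagonal in the limit of infinitely many samples.
  Testing the eigenvalue equation for \<open>e l\<close> with \<open>e m\<close> shows that the entries of the
  empirical matrix have expectation \<open>lam m\<close> on the diagonal and \<open>0\<close> off it, and those of the
  empirical vector have expectation \<open>\<langle>h, e m\<rangle>\<close>. Testing the Poisson equation with \<open>e m\<close>, and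
  the eigenvalue equation with \<open>\<phi>\<close>, gives \<open>lam m * \<langle>\<phi>, e m\<rangle> = \<langle>h, e m\<rangle>\<close>; so the exact
  solution of the limiting system consists of the coefficients \<open>\<langle>\<phi>, e m\<rangle>\<close> of \<open>\<phi>\<close> itself.

  The entries are averages of independent, identically distributed variables of which only
  integrability is known, being sums of products of functions in \<open>L\<^sup>2\<close>. Their almost sure
  convergence is therefore Kolmogorov's strong law under a first moment condition
  (\<open>strong_law_of_large_numbers\<close>), proved here by Etemadi's method: a nonnegative sequence is
  truncated, second moments control the averages along a geometric subsequence of indices, and
  monotonicity of the partial sums fills the gaps.

  All eigenvalues that occur are at least \<open>lam 1 > 0\<close>. A matrix close to such a diagonal matrix
  is invertible, and its solutions depend continuously on the data, uniformly in a neighbourhood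
  (\<open>near_diagonal_system_solvable\<close>, \<open>diagonal_system_perturbation\<close>). Hence almost surely the
  system is solvable for all large \<open>N\<close>, and then \<open>c N\<close> converges to the exact coefficients.
  Almost sure eventual solvability gives probabilities tending to \<open>1\<close> once solvability is known
  to be an event (\<open>solvability_measurable\<close>).

  Finally, orthonormality splits the squared error into the squared distance of the coefficients
  and the squared tail of the expansion of \<open>\<phi>\<close> beyond \<open>M\<close>. In the tail
  \<open>\<langle>\<phi>, e m\<rangle> = \<langle>h, e m\<rangle> / lam m\<close> with \<open>lam m \<ge> lam M\<close>, so Parseval's identity bounds it by
  \<open>(\<parallel>h\<parallel> / lam M)\<^sup>2\<close> (\<open>spectral_truncation_error\<close>). Where the system is solvable,
  the random variable \<open>\<epsilon> N\<close> is the \<open>\<ell>\<^sup>1\<close> distance of the coefficients.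
\<close>

section \<open>Elementary estimates for sums and averages\<close>

text \<open>
  Applied to a nonnegative random variable, this bounds the sum of the probabilities that the variable
  exceeds \<open>1, 2, 3, \<dots>\<close> by its expectation.
\<close>

lemma sum_indicator_exceeded_indices_le:
  fixes y :: real
  assumes "0 \<le> y"
  shows "(\<Sum>i<n. indicator {real i + 1<..} y) \<le> y"
proof (induction n)
  case 0
  then show ?case using assms by simp
next
  case (Suc n)
  show ?case
  proof (cases "real n + 1 < y")
    case True
    have "(\<Sum>i<n. indicator {real i + 1<..} y) \<le> (\<Sum>i<n. (1::real))"
      by (intro sum_mono) (auto simp: indicator_def)
    with True show ?thesis by (simp add: indicator_def)
  next
    case False
    with Suc show ?thesis by simp
  qed
qed

text \<open>
  The indicator keeps only those \<open>n\<close> with \<open>y \<le> \<lceil>\<alpha> ^ n\<rceil>\<close>. Over them \<open>1 / \<alpha> ^ n\<close> is a geometric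
  series whose first term is at most \<open>2 / y\<close>, so the factor \<open>y\<close> cancels and the bound depends on
  \<open>\<alpha>\<close> alone. This is the point at which a second moment of a truncated variable is traded for a
  first moment.
\<close>

lemma sum_over_large_powers_le:
  fixes \<alpha> y :: real
  assumes a: "1 < \<alpha>" and y: "0 \<le> y"
  shows "(\<Sum>n<N. y / real (nat \<lceil>\<alpha> ^ n\<rceil>) * indicator {..real (nat \<lceil>\<alpha> ^ n\<rceil>)} y) \<le> 2 * \<alpha> / (\<alpha> - 1)"
proof -
  have k1: "\<alpha> ^ n \<le> real (nat \<lceil>\<alpha> ^ n\<rceil>)" "real (nat \<lceil>\<alpha> ^ n\<rceil>) \<le> 2 * \<alpha> ^ n" for n
  proof -
    have "1 \<le> \<alpha> ^ n" using a by simp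
    then show "\<alpha> ^ n \<le> real (nat \<lceil>\<alpha> ^ n\<rceil>)" "real (nat \<lceil>\<alpha> ^ n\<rceil>) \<le> 2 * \<alpha> ^ n"
      by linarith+
  qed
  show ?thesis
  proof (cases "y = 0")
    case True
    then show ?thesis using a by simp
  next
    case False
    with y have y0: "0 < y" by simp
    \<comment> \<open>As \<open>\<lceil>\<alpha> ^ n\<rceil> \<le> 2 * \<alpha> ^ n\<close>, only indices with \<open>y / 2 \<le> \<alpha> ^ n\<close> contribute.\<close>
    obtain m where m: "y / 2 \<le> \<alpha> ^ m" using real_arch_pow[OF a, of "y/2"] by (meson less_imp_le)
    define n0 where "n0 = (LEAST m. y / 2 \<le> \<alpha> ^ m)"
    have n0: "y / 2 \<le> \<alpha> ^ n0" unfolding n0_def by (rule LeastI[of _ m]) (rule m)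
    have below: "\<not> y / 2 \<le> \<alpha> ^ n" if "n < n0" for n
      using that not_less_Least unfolding n0_def by blast
    have "(\<Sum>n<N. y / real (nat \<lceil>\<alpha> ^ n\<rceil>) * indicator {..real (nat \<lceil>\<alpha> ^ n\<rceil>)} y)
        \<le> (\<Sum>n<n0 + N. y / real (nat \<lceil>\<alpha> ^ n\<rceil>) * indicator {..real (nat \<lceil>\<alpha> ^ n\<rceil>)} y)"
      by (intro sum_mono2) (use y0 in auto)
    also have "\<dots> \<le> (\<Sum>n<n0 + N. if n < n0 then 0 else 2 * (1 / \<alpha>) ^ (n - n0))"
    proof (intro sum_mono)
      fix n
      show "y / real (nat \<lceil>\<alpha> ^ n\<rceil>) * indicator {..real (nat \<lceil>\<alpha> ^ n\<rceil>)} y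
          \<le> (if n < n0 then 0 else 2 * (1 / \<alpha>) ^ (n - n0))"
      proof (cases "n < n0")
        case True
        have "real (nat \<lceil>\<alpha> ^ n\<rceil>) < y" using below[OF True] k1(2)[of n] by linarith
        with True show ?thesis by simp
      next
        case False
        then have split: "\<alpha> ^ n = \<alpha> ^ n0 * \<alpha> ^ (n - n0)" by (simp flip: power_add)
        have "y / real (nat \<lceil>\<alpha> ^ n\<rceil>) * indicator {..real (nat \<lceil>\<alpha> ^ n\<rceil>)} y \<le> y / real (nat \<lceil>\<alpha> ^ n\<rceil>)"
          using y0 by (auto simp: indicator_def)
        also have "\<dots> \<le> y / \<alpha> ^ n" using k1(1)[of n] y0 a by (intro divide_left_mono) (auto simp: mult_pos_pos)
        also have "\<dots> \<le> (2 * \<alpha> ^ n0) / \<alpha> ^ n" using n0 a by (intro divide_right_mono) auto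
        also have "\<dots> = 2 * (1 / \<alpha>) ^ (n - n0)" unfolding split using a by (simp add: field_simps)
        finally show ?thesis using False by simp
      qed
    qed
    also have "\<dots> = 2 * (\<Sum>n<N. (1 / \<alpha>) ^ n)"
    proof -
      have "(\<Sum>n<n0 + N. if n < n0 then 0 else 2 * (1 / \<alpha>) ^ (n - n0))
          = (\<Sum>n\<in>{n0..<n0 + N}. 2 * (1 / \<alpha>) ^ (n - n0))"
        by (intro sum.mono_neutral_cong_right) auto
      also have "\<dots> = (\<Sum>n\<in>{0..<N}. 2 * (1 / \<alpha>) ^ n)"
        using sum.shift_bounds_nat_ivl[of "\<lambda>n. 2 * (1 / \<alpha>) ^ (n - n0)" 0 n0 N] by (simp add: add.commute)
      finally show ?thesis by (simp add: sum_distrib_left atLeast0LessThan)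
    qed
    also have "\<dots> \<le> 2 * (\<Sum>n. (1 / \<alpha>) ^ n)"
      using a by (intro mult_left_mono sum_le_suminf summable_geometric) auto
    also have "\<dots> = 2 * \<alpha> / (\<alpha> - 1)" using a by (subst suminf_geometric) (auto simp: field_simps)
    finally show ?thesis .
  qed
qed

text \<open>
  For \<open>\<alpha> ^ j \<le> n < \<alpha> ^ (j + 1)\<close>, monotonicity squeezes \<open>S n / n\<close> between averages along the
  geometric subsequence, up to a factor that tends to \<open>\<alpha>\<close>. Ratios \<open>\<alpha> = 1 + 1 / (p + 1)\<close> suffice,
  and there are only countably many of them, so that almost sure statements can be combined.
\<close>

lemma mono_averages_interpolate:
  fixes S :: "nat \<Rightarrow> real"
  assumes mono: "mono S" and S0: "0 \<le> S 0" and L0: "0 \<le> L"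
    and sub: "\<And>p::nat. (\<lambda>n. S (nat \<lceil>(1 + 1 / (real p + 1)) ^ n\<rceil>) / real (nat \<lceil>(1 + 1 / (real p + 1)) ^ n\<rceil>)) \<longlonglongrightarrow> L"
  shows "(\<lambda>n. S n / real n) \<longlonglongrightarrow> L"
proof -
  have key: "\<forall>\<^sub>F n in sequentially. l < S n / real n \<and> S n / real n < u"
    if a: "1 < \<alpha>" and lim: "(\<lambda>n. S (nat \<lceil>\<alpha> ^ n\<rceil>) / real (nat \<lceil>\<alpha> ^ n\<rceil>)) \<longlonglongrightarrow> L"
      and l: "l < L / \<alpha>" and u: "L * \<alpha> < u" for \<alpha> l u :: real
  proof -
    define k where "k n = nat \<lceil>\<alpha> ^ n\<rceil>" for n
    have pow1: "1 \<le> \<alpha> ^ n" for n using a by simp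
    have k: "\<alpha> ^ n \<le> real (k n)" "real (k n) < \<alpha> ^ n + 1" for n
      unfolding k_def using pow1[of n] by linarith+
    have ratio: "(\<lambda>n. real (k n) / \<alpha> ^ n) \<longlonglongrightarrow> 1"
    proof (rule tendsto_sandwich[of "\<lambda>_. 1" _ _ "\<lambda>n. 1 + (1 / \<alpha>) ^ n"])
      show "\<forall>\<^sub>F n in sequentially. 1 \<le> real (k n) / \<alpha> ^ n"
        using k(1) a by (intro always_eventually) (simp add: le_divide_eq)
      show "\<forall>\<^sub>F n in sequentially. real (k n) / \<alpha> ^ n \<le> 1 + (1 / \<alpha>) ^ n"
        using k(2) a by (intro always_eventually) (auto simp: field_simps intro: less_imp_le)
      have "(\<lambda>n. (1 / \<alpha>) ^ n) \<longlonglongrightarrow> 0" using a by (intro LIMSEQ_power_zero) auto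
      then show "(\<lambda>n. 1 + (1 / \<alpha>) ^ n) \<longlonglongrightarrow> 1" using tendsto_add[OF tendsto_const] by force
    qed auto
    have lim': "(\<lambda>n. S (k n) / \<alpha> ^ n) \<longlonglongrightarrow> L"
    proof -
      have "(\<lambda>n. S (k n) / real (k n) * (real (k n) / \<alpha> ^ n)) \<longlonglongrightarrow> L * 1"
        using lim unfolding k_def[symmetric] by (intro tendsto_mult ratio)
      moreover have "S (k n) / real (k n) * (real (k n) / \<alpha> ^ n) = S (k n) / \<alpha> ^ n" for n
        using k(1)[of n] pow1[of n] by simp
      ultimately show ?thesis by (simp only: mult_1_right)
    qed
    have "(\<lambda>n. S (k n) / \<alpha> ^ n / \<alpha>) \<longlonglongrightarrow> L / \<alpha>" using a by (intro tendsto_divide lim') auto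
    from order_tendstoD(1)[OF this l] have ev1: "\<forall>\<^sub>F n in sequentially. l < S (k n) / \<alpha> ^ n / \<alpha>" .
    have "(\<lambda>n. S (k (Suc n)) / \<alpha> ^ Suc n * \<alpha>) \<longlonglongrightarrow> L * \<alpha>"
      by (rule tendsto_mult_right[OF LIMSEQ_Suc[OF lim']])
    from order_tendstoD(2)[OF this u] have "\<forall>\<^sub>F n in sequentially. S (k (Suc n)) / \<alpha> ^ Suc n * \<alpha> < u" .
    with ev1 have "\<forall>\<^sub>F n in sequentially. l < S (k n) / \<alpha> ^ Suc n \<and> S (k (Suc n)) / \<alpha> ^ n < u"
    proof eventually_elim
      case (elim n)
      have "S (k n) / \<alpha> ^ Suc n = S (k n) / \<alpha> ^ n / \<alpha>"
        and "S (k (Suc n)) / \<alpha> ^ n = S (k (Suc n)) / \<alpha> ^ Suc n * \<alpha>"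
        using a by (simp_all add: field_simps)
      with elim show ?case by (simp only:)
    qed
    then obtain J where J: "\<And>n. n \<ge> J \<Longrightarrow> l < S (k n) / \<alpha> ^ Suc n \<and> S (k (Suc n)) / \<alpha> ^ n < u"
      unfolding eventually_sequentially by blast
    have Snn: "0 \<le> S n" for n using monoD[OF mono, of 0 n] S0 by simp
    show ?thesis unfolding eventually_sequentially
    proof (intro exI allI impI)
      fix n assume n: "k J \<le> n"
      have nJ: "\<alpha> ^ J \<le> real n" using n k(1)[of J] by linarith
      define j where "j = nat \<lfloor>log \<alpha> (real n)\<rfloor>"
      have npos: "1 \<le> real n" using nJ pow1[of J] by linarith
      have lg: "real J \<le> log \<alpha> (real n)"
        using nJ npos a by (simp add: le_log_iff powr_realpow)
      have jJ: "J \<le> j" unfolding j_def using lg by linarith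
      have j1: "real j \<le> log \<alpha> (real n)" and j2: "log \<alpha> (real n) < real j + 1"
        unfolding j_def using lg by linarith+
      have p1: "\<alpha> ^ j \<le> real n" using j1 npos a by (simp add: le_log_iff powr_realpow)
      have p2: "real n < \<alpha> ^ Suc j"
      proof -
        have "real n < \<alpha> powr (real (Suc j))" using j2 npos a by (simp add: log_less_iff algebra_simps)
        then show ?thesis using a by (simp only: powr_realpow)
      qed
      have kj: "k j \<le> n" unfolding k_def using p1 by linarith
      have kj2: "n \<le> k (Suc j)" using k(1)[of "Suc j"] p2 by linarith
      have "l < S (k j) / \<alpha> ^ Suc j" using J[OF jJ] by simp
      also have "\<dots> \<le> S (k j) / real n" using p2 npos Snn a by (intro divide_left_mono) auto
      also have "\<dots> \<le> S n / real n" using npos monoD[OF mono kj] by (intro divide_right_mono) auto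
      finally have A: "l < S n / real n" .
      have "S n / real n \<le> S (k (Suc j)) / real n" using npos monoD[OF mono kj2] by (intro divide_right_mono) auto
      also have "\<dots> \<le> S (k (Suc j)) / \<alpha> ^ j" using p1 npos Snn a by (intro divide_left_mono) auto
      also have "\<dots> < u" using J[OF jJ] by simp
      finally show "l < S n / real n \<and> S n / real n < u" using A by simp
    qed
  qed
  have ratio_lim: "(\<lambda>p. 1 + 1 / (real p + 1)) \<longlonglongrightarrow> 1"
    using tendsto_add[OF tendsto_const LIMSEQ_inverse_real_of_nat, of 1]
    by (simp add: inverse_eq_divide add.commute)
  have l1: "(\<lambda>p. L / (1 + 1 / (real p + 1))) \<longlonglongrightarrow> L"
    using tendsto_divide[OF tendsto_const ratio_lim, of L] by simp
  have l2: "(\<lambda>p. L * (1 + 1 / (real p + 1))) \<longlonglongrightarrow> L"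
    using tendsto_mult[OF tendsto_const ratio_lim, of L] by simp
  show ?thesis
  proof (rule order_tendstoI)
    fix l assume lu: "l < L"
    from eventually_happens'[OF sequentially_bot order_tendstoD(1)[OF l1 lu]]
    obtain p where p: "l < L / (1 + 1 / (real p + 1))" by blast
    from key[OF _ sub p, of "L * (1 + 1 / (real p + 1)) + 1"]
    show "\<forall>\<^sub>F n in sequentially. l < S n / real n" by (auto elim: eventually_mono)
  next
    fix u assume lu: "L < u"
    from eventually_happens'[OF sequentially_bot order_tendstoD(2)[OF l2 lu]]
    obtain p where p: "L * (1 + 1 / (real p + 1)) < u" by blast
    from key[OF _ sub _ p, of "L / (1 + 1 / (real p + 1)) - 1"]
    show "\<forall>\<^sub>F n in sequentially. S n / real n < u" by (auto elim: eventually_mono)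
  qed
qed

section \<open>The strong law of large numbers\<close>

context prob_space
begin

lemma expectation_square_sum_indep:
  fixes W :: "nat \<Rightarrow> 'a \<Rightarrow> real"
  assumes ind: "indep_vars (\<lambda>_. borel) W UNIV"
    and sq: "\<And>i. integrable M (\<lambda>\<omega>. (W i \<omega>)\<^sup>2)"
    and int: "\<And>i. integrable M (W i)"
    and mean: "\<And>i. expectation (W i) = 0"
  shows "integrable M (\<lambda>\<omega>. (\<Sum>i<n. W i \<omega>)\<^sup>2)"
    and "expectation (\<lambda>\<omega>. (\<Sum>i<n. W i \<omega>)\<^sup>2) = (\<Sum>i<n. expectation (\<lambda>\<omega>. (W i \<omega>)\<^sup>2))"
proof -
  have cross: "integrable M (\<lambda>\<omega>. W i \<omega> * W j \<omega>)"
      "expectation (\<lambda>\<omega>. W i \<omega> * W j \<omega>) = (if i = j then expectation (\<lambda>\<omega>. (W i \<omega>)\<^sup>2) else 0)" for i j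
  proof -
    have "integrable M (\<lambda>\<omega>. W i \<omega> * W j \<omega>) \<and> expectation (\<lambda>\<omega>. W i \<omega> * W j \<omega>) = 0" if "i \<noteq> j"
    proof -
      have ij: "indep_vars (\<lambda>_. borel) W {i, j}" using ind by (rule indep_vars_subset) auto
      from indep_vars_lebesgue_integral[OF _ ij int] indep_vars_integrable[OF _ ij int]
      show ?thesis using that mean by simp
    qed
    then show "integrable M (\<lambda>\<omega>. W i \<omega> * W j \<omega>)"
      "expectation (\<lambda>\<omega>. W i \<omega> * W j \<omega>) = (if i = j then expectation (\<lambda>\<omega>. (W i \<omega>)\<^sup>2) else 0)"
      using sq[of i] by (cases "i = j"; simp add: power2_eq_square)+
  qed
  have eq: "(\<Sum>i<n. W i \<omega>)\<^sup>2 = (\<Sum>i<n. \<Sum>j<n. W i \<omega> * W j \<omega>)" for \<omega>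
    by (simp add: power2_eq_square sum_product)
  show "integrable M (\<lambda>\<omega>. (\<Sum>i<n. W i \<omega>)\<^sup>2)"
    unfolding eq using cross(1) by (intro Bochner_Integration.integrable_sum)
  have "expectation (\<lambda>\<omega>. (\<Sum>i<n. W i \<omega>)\<^sup>2) = (\<Sum>i<n. \<Sum>j<n. expectation (\<lambda>\<omega>. W i \<omega> * W j \<omega>))"
    unfolding eq using cross(1) by (subst Bochner_Integration.integral_sum; simp)+
  then show "expectation (\<lambda>\<omega>. (\<Sum>i<n. W i \<omega>)\<^sup>2) = (\<Sum>i<n. expectation (\<lambda>\<omega>. (W i \<omega>)\<^sup>2))"
    by (simp add: cross(2))
qed

lemma expectation_cong_distr:
  fixes g :: "real \<Rightarrow> real"
  assumes [measurable]: "Y \<in> borel_measurable M" "Z \<in> borel_measurable M" "g \<in> borel_measurable borel"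
    and d: "distr M borel Y = distr M borel Z"
  shows "expectation (\<lambda>\<omega>. g (Y \<omega>)) = expectation (\<lambda>\<omega>. g (Z \<omega>))"
  using integral_distr[of Y M borel g] integral_distr[of Z M borel g] d by simp

text \<open>
  Borel--Cantelli: the probabilities of \<open>i + 1 < Y i\<close> are those of \<open>i + 1 < Y 0\<close>, and their sum is
  at most the expectation of \<open>Y 0\<close>.
\<close>

lemma AE_eventually_le_index:
  fixes Y :: "nat \<Rightarrow> 'a \<Rightarrow> real"
  assumes [measurable]: "\<And>i. Y i \<in> borel_measurable M"
    and distr: "\<And>i. distr M borel (Y i) = distr M borel (Y 0)"
    and int: "integrable M (Y 0)" and nn: "\<And>\<omega>. 0 \<le> Y 0 \<omega>"
  shows "AE \<omega> in M. \<forall>\<^sub>F i in sequentially. Y i \<omega> \<le> real i + 1"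
proof -
  define A where "A i = {\<omega>\<in>space M. real i + 1 < Y i \<omega>}" for i
  have A[measurable]: "A i \<in> sets M" for i unfolding A_def by measurable
  have pA: "prob (A i) = expectation (\<lambda>\<omega>. indicator {real i + 1<..} (Y 0 \<omega>))" for i
  proof -
    have "prob (A i) = expectation (indicator (A i))" by simp
    also have "\<dots> = expectation (\<lambda>\<omega>. indicator {real i + 1<..} (Y i \<omega>))"
      by (intro Bochner_Integration.integral_cong) (auto simp: A_def indicator_def)
    also have "\<dots> = expectation (\<lambda>\<omega>. indicator {real i + 1<..} (Y 0 \<omega>))"
      by (rule expectation_cong_distr) (auto intro: distr)
    finally show ?thesis .
  qed
  have ii: "integrable M (\<lambda>\<omega>. indicator {real i + 1<..} (Y 0 \<omega>) :: real)" for i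
    by (rule integrable_const_bound[where B=1]) (auto simp: indicator_def)
  have "summable (\<lambda>i. prob (A i))"
  proof (rule summableI_nonneg_bounded[where x="expectation (Y 0)"])
    fix n
    have "(\<Sum>i<n. prob (A i)) = expectation (\<lambda>\<omega>. \<Sum>i<n. indicator {real i + 1<..} (Y 0 \<omega>))"
      unfolding pA using ii by (subst Bochner_Integration.integral_sum) auto
    also have "\<dots> \<le> expectation (Y 0)"
      using sum_indicator_exceeded_indices_le[OF nn] ii int by (intro integral_mono Bochner_Integration.integrable_sum) auto
    finally show "(\<Sum>i<n. prob (A i)) \<le> expectation (Y 0)" .
  qed auto
  then have "AE \<omega> in M. \<forall>\<^sub>F i in sequentially. \<omega> \<in> space M - A i"
    by (intro borel_cantelli_AE1) (auto simp: emeasure_eq_measure)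
  then show ?thesis
    by eventually_elim (auto elim!: eventually_mono simp: A_def)
qed

text \<open>
  By monotone convergence the sum of the squares has a finite expectation, hence is almost surely
  finite, and the terms of a convergent series tend to \<open>0\<close>.
\<close>

lemma AE_tendsto_0_if_summable_squares:
  fixes T :: "nat \<Rightarrow> 'a \<Rightarrow> real"
  assumes int: "\<And>n. integrable M (\<lambda>\<omega>. (T n \<omega>)\<^sup>2)"
    and sum: "summable (\<lambda>n. expectation (\<lambda>\<omega>. (T n \<omega>)\<^sup>2))"
  shows "AE \<omega> in M. (\<lambda>n. T n \<omega>) \<longlonglongrightarrow> 0"
proof -
  have [measurable]: "(\<lambda>\<omega>. (T n \<omega>)\<^sup>2) \<in> borel_measurable M" for n using int by auto
  have "(\<integral>\<^sup>+\<omega>. (\<Sum>n. ennreal ((T n \<omega>)\<^sup>2)) \<partial>M) = (\<Sum>n. \<integral>\<^sup>+\<omega>. ennreal ((T n \<omega>)\<^sup>2) \<partial>M)"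
    by (rule nn_integral_suminf) measurable
  also have "\<dots> = (\<Sum>n. ennreal (expectation (\<lambda>\<omega>. (T n \<omega>)\<^sup>2)))"
    using int by (subst nn_integral_eq_integral) auto
  also have "\<dots> = ennreal (\<Sum>n. expectation (\<lambda>\<omega>. (T n \<omega>)\<^sup>2))"
    by (intro suminf_ennreal2 sum Bochner_Integration.integral_nonneg) auto
  finally have "(\<integral>\<^sup>+\<omega>. (\<Sum>n. ennreal ((T n \<omega>)\<^sup>2)) \<partial>M) \<noteq> \<infinity>" by simp
  then have "AE \<omega> in M. (\<Sum>n. ennreal ((T n \<omega>)\<^sup>2)) \<noteq> \<infinity>"
    by (intro nn_integral_PInf_AE) measurable
  then show ?thesis
  proof eventually_elim
    case (elim \<omega>)
    then have "summable (\<lambda>n. (T n \<omega>)\<^sup>2)" by (intro summable_suminf_not_top) auto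
    then have "(\<lambda>n. (T n \<omega>)\<^sup>2) \<longlonglongrightarrow> 0" by (rule summable_LIMSEQ_zero)
    then have "(\<lambda>n. sqrt ((T n \<omega>)\<^sup>2)) \<longlonglongrightarrow> sqrt 0" by (rule tendsto_real_sqrt)
    then show ?case by (simp add: tendsto_rabs_zero_iff)
  qed
qed

text \<open>
  All the variables entering the \<open>n\<close>-th average are truncated at the same level, their number
  \<open>k n = \<lceil>\<alpha> ^ n\<rceil>\<close>. They then stay identically distributed, so that the truncated average has
  mean \<open>E (tr n (Y 0))\<close>, which tends to \<open>E (Y 0)\<close> by dominated convergence, and variance at most
  \<open>E ((tr n (Y 0))\<^sup>2) / k n\<close>, which is summable by \<open>sum_over_large_powers_le\<close>. Almost surely the
  truncation changes only finitely many of these averages.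
\<close>

lemma strong_law_geometric_subsequence:
  fixes Y :: "nat \<Rightarrow> 'a \<Rightarrow> real"  and \<alpha> :: real
  assumes ind: "indep_vars (\<lambda>_. borel) Y UNIV"
    and distr: "\<And>i. distr M borel (Y i) = distr M borel (Y 0)"
    and int: "integrable M (Y 0)" and nn: "\<And>i \<omega>. 0 \<le> Y i \<omega>"
    and a: "1 < \<alpha>"
  shows "AE \<omega> in M. (\<lambda>n. (\<Sum>i<nat \<lceil>\<alpha> ^ n\<rceil>. Y i \<omega>) / real (nat \<lceil>\<alpha> ^ n\<rceil>)) \<longlonglongrightarrow> expectation (Y 0)"
proof -
  define k where "k n = nat \<lceil>\<alpha> ^ n\<rceil>" for n
  define tr where "tr n y = y * indicator {..real (k n)} y" for n and y :: real
  have [measurable]: "Y i \<in> borel_measurable M" for i using ind by (simp add: indep_vars_def)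
  have [measurable]: "tr n \<in> borel_measurable borel" for n unfolding tr_def by measurable
  have k_ge: "\<alpha> ^ n \<le> real (k n)" for n unfolding k_def by linarith
  have pow1: "1 \<le> \<alpha> ^ n" for n using a by simp
  have k_pos: "0 < real (k n)" for n using k_ge[of n] pow1[of n] by linarith
  have tr_bound: "\<bar>tr n (Y i \<omega>)\<bar> \<le> real (k n)" for n i \<omega>
    using nn[of i \<omega>] by (auto simp: tr_def indicator_def)
  have tr_int: "integrable M (\<lambda>\<omega>. tr n (Y i \<omega>))" for n i
    by (rule integrable_const_bound[where B="real (k n)"]) (use tr_bound in auto)
  have tr_sq_int: "integrable M (\<lambda>\<omega>. (tr n (Y i \<omega>))\<^sup>2)" for n i
    by (rule integrable_const_bound[where B="(real (k n))\<^sup>2"])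
       (use tr_bound in \<open>auto simp: abs_le_square_iff[symmetric]\<close>)
  define m where "m n = expectation (\<lambda>\<omega>. tr n (Y 0 \<omega>))" for n
  have mean: "expectation (\<lambda>\<omega>. tr n (Y i \<omega>)) = m n" for n i
    unfolding m_def by (rule expectation_cong_distr) (auto intro: distr)
  define T where "T n \<omega> = (\<Sum>i<k n. tr n (Y i \<omega>) - m n) / real (k n)" for n \<omega>
  have W: "indep_vars (\<lambda>_. borel) (\<lambda>i \<omega>. tr n (Y i \<omega>) - m n) UNIV" for n
    by (rule indep_vars_compose2[OF ind, of "\<lambda>_ y. tr n y - m n" "\<lambda>_. borel"]) simp
  have W_sq: "integrable M (\<lambda>\<omega>. (tr n (Y i \<omega>) - m n)\<^sup>2)" for n i
    unfolding power2_diff using tr_int tr_sq_int by (intro Bochner_Integration.integrable_add Bochner_Integration.integrable_diff) auto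
  have W_int: "integrable M (\<lambda>\<omega>. tr n (Y i \<omega>) - m n)" for n i
    using tr_int by auto
  have W_mean: "expectation (\<lambda>\<omega>. tr n (Y i \<omega>) - m n) = 0" for n i
    using tr_int mean by (simp add: prob_space)
  have T_int: "integrable M (\<lambda>\<omega>. (T n \<omega>)\<^sup>2)" for n
    unfolding T_def power_divide
    using expectation_square_sum_indep(1)[OF W W_sq W_int W_mean] by auto
  have T_le: "expectation (\<lambda>\<omega>. (T n \<omega>)\<^sup>2) \<le> expectation (\<lambda>\<omega>. (tr n (Y 0 \<omega>))\<^sup>2 / real (k n))" for n
  proof -
    have var: "expectation (\<lambda>\<omega>. (tr n (Y i \<omega>) - m n)\<^sup>2) \<le> expectation (\<lambda>\<omega>. (tr n (Y 0 \<omega>))\<^sup>2)" for i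
    proof -
      have "expectation (\<lambda>\<omega>. (tr n (Y i \<omega>) - m n)\<^sup>2) = expectation (\<lambda>\<omega>. (tr n (Y i \<omega>))\<^sup>2) - (m n)\<^sup>2"
        using variance_eq[OF tr_int tr_sq_int, of n i] by (simp add: mean)
      also have "expectation (\<lambda>\<omega>. (tr n (Y i \<omega>))\<^sup>2) = expectation (\<lambda>\<omega>. (tr n (Y 0 \<omega>))\<^sup>2)"
        by (rule expectation_cong_distr[where g="\<lambda>y. (tr n y)\<^sup>2"]) (auto intro: distr)
      finally show ?thesis by simp
    qed
    have "expectation (\<lambda>\<omega>. (T n \<omega>)\<^sup>2) = (\<Sum>i<k n. expectation (\<lambda>\<omega>. (tr n (Y i \<omega>) - m n)\<^sup>2)) / (real (k n))\<^sup>2"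
      unfolding T_def power_divide
      using expectation_square_sum_indep(2)[OF W W_sq W_int W_mean] by simp
    also have "\<dots> \<le> (\<Sum>i<k n. expectation (\<lambda>\<omega>. (tr n (Y 0 \<omega>))\<^sup>2)) / (real (k n))\<^sup>2"
      by (intro divide_right_mono sum_mono var) auto
    also have "\<dots> = expectation (\<lambda>\<omega>. (tr n (Y 0 \<omega>))\<^sup>2 / real (k n))"
      using k_pos[of n] by (simp add: power2_eq_square)
    finally show ?thesis .
  qed
  define C where "C = 2 * \<alpha> / (\<alpha> - 1)"
  have trunc_sum: "(\<Sum>n<N. (tr n y)\<^sup>2 / real (k n)) \<le> C * y" if "0 \<le> y" for y N
  proof -
    have "(\<Sum>n<N. (tr n y)\<^sup>2 / real (k n)) = y * (\<Sum>n<N. y / real (k n) * indicator {..real (k n)} y)"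
      unfolding sum_distrib_left by (intro sum.cong) (auto simp: tr_def indicator_def power2_eq_square)
    also have "\<dots> \<le> y * C"
      unfolding C_def k_def using that sum_over_large_powers_le[OF a that] by (intro mult_left_mono)
    finally show ?thesis by (simp add: mult.commute)
  qed
  have "summable (\<lambda>n. expectation (\<lambda>\<omega>. (tr n (Y 0 \<omega>))\<^sup>2 / real (k n)))"
  proof (rule summableI_nonneg_bounded[where x="C * expectation (Y 0)"])
    fix N
    have "(\<Sum>n<N. expectation (\<lambda>\<omega>. (tr n (Y 0 \<omega>))\<^sup>2 / real (k n)))
        = expectation (\<lambda>\<omega>. \<Sum>n<N. (tr n (Y 0 \<omega>))\<^sup>2 / real (k n))"
      using tr_sq_int by (subst Bochner_Integration.integral_sum) auto
    also have "\<dots> \<le> expectation (\<lambda>\<omega>. C * Y 0 \<omega>)"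
      using trunc_sum[OF nn] int tr_sq_int
      by (intro integral_mono Bochner_Integration.integrable_sum) auto
    finally show "(\<Sum>n<N. expectation (\<lambda>\<omega>. (tr n (Y 0 \<omega>))\<^sup>2 / real (k n))) \<le> C * expectation (Y 0)"
      using int by simp
  qed (auto intro!: Bochner_Integration.integral_nonneg)
  then have "summable (\<lambda>n. expectation (\<lambda>\<omega>. (T n \<omega>)\<^sup>2))"
    by (rule summable_comparison_test') (use T_le in \<open>auto intro: Bochner_Integration.integral_nonneg\<close>)
  from AE_tendsto_0_if_summable_squares[OF T_int this]
  have AE1: "AE \<omega> in M. (\<lambda>n. T n \<omega>) \<longlonglongrightarrow> 0" .
  have k_top: "filterlim (\<lambda>n. real (k n)) at_top sequentially"
  proof (rule filterlim_at_top_mono[where f="\<lambda>n. \<alpha> ^ n"])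
    show "filterlim (\<lambda>n. \<alpha> ^ n) at_top sequentially" using a pow1
      by (intro filterlim_at_infinity_imp_filterlim_at_top filterlim_realpow_sequentially_gt1 always_eventually)
        (auto intro: less_le_trans[OF zero_less_one])
  qed (use k_ge in auto)
  have m_lim: "m \<longlonglongrightarrow> expectation (Y 0)"
    unfolding m_def
  proof (rule integral_dominated_convergence[where w="Y 0"])
    show "AE \<omega> in M. (\<lambda>n. tr n (Y 0 \<omega>)) \<longlonglongrightarrow> Y 0 \<omega>"
    proof (intro always_eventually allI)
      fix \<omega>
      have "\<forall>\<^sub>F n in sequentially. Y 0 \<omega> \<le> real (k n)"
        using k_top by (simp add: filterlim_at_top)
      then have "\<forall>\<^sub>F n in sequentially. tr n (Y 0 \<omega>) = Y 0 \<omega>"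
        by eventually_elim (simp add: tr_def)
      then show "(\<lambda>n. tr n (Y 0 \<omega>)) \<longlonglongrightarrow> Y 0 \<omega>" by (rule tendsto_eventually)
    qed
    show "AE \<omega> in M. norm (tr n (Y 0 \<omega>)) \<le> Y 0 \<omega>" for n
      using nn by (auto simp: tr_def indicator_def)
  qed (use int in auto)
  have "AE \<omega> in M. \<forall>\<^sub>F i in sequentially. Y i \<omega> \<le> real i + 1"
    by (rule AE_eventually_le_index[of Y, OF _ distr int nn]) simp
  with AE1 show ?thesis unfolding k_def[symmetric]
  proof eventually_elim
    case (elim \<omega>)
    \<comment> \<open>Terms with \<open>i \<ge> i0\<close> are at most \<open>i + 1 \<le> k n\<close>; the others are at most \<open>k n\<close> for large \<open>n\<close>.\<close>
    from elim(2) obtain i0 where i0: "\<And>i. i \<ge> i0 \<Longrightarrow> Y i \<omega> \<le> real i + 1"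
      unfolding eventually_sequentially by blast
    have "\<forall>\<^sub>F n in sequentially. (\<Sum>i<i0. Y i \<omega>) \<le> real (k n)"
      using k_top by (simp add: filterlim_at_top)
    then have "\<forall>\<^sub>F n in sequentially. T n \<omega> + m n = (\<Sum>i<k n. Y i \<omega>) / real (k n)"
    proof eventually_elim
      case (elim n)
      have "tr n (Y i \<omega>) = Y i \<omega>" if "i < k n" for i
      proof -
        have "Y i \<omega> \<le> real (k n)"
        proof (cases "i < i0")
          case True
          then have "Y i \<omega> \<le> (\<Sum>i<i0. Y i \<omega>)" using nn by (intro member_le_sum) auto
          with elim show ?thesis by simp
        next
          case False
          with i0[of i] that show ?thesis by linarith
        qed
        then show ?thesis by (simp add: tr_def)
      qed
      then show ?case using k_pos[of n]
        by (simp add: T_def sum_subtractf diff_divide_distrib)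
    qed
    moreover have "(\<lambda>n. T n \<omega> + m n) \<longlonglongrightarrow> 0 + expectation (Y 0)"
      by (intro tendsto_add elim(1) m_lim)
    ultimately show ?case by (auto elim: Lim_transform_eventually)
  qed
qed

lemma strong_law_nonneg:
  fixes Y :: "nat \<Rightarrow> 'a \<Rightarrow> real"
  assumes ind: "indep_vars (\<lambda>_. borel) Y UNIV"
    and distr: "\<And>i. distr M borel (Y i) = distr M borel (Y 0)"
    and int: "integrable M (Y 0)" and nn: "\<And>i \<omega>. 0 \<le> Y i \<omega>"
  shows "AE \<omega> in M. (\<lambda>n. (\<Sum>i<n. Y i \<omega>) / real n) \<longlonglongrightarrow> expectation (Y 0)"
proof -
  have "AE \<omega> in M. \<forall>p::nat. (\<lambda>n. (\<Sum>i<nat \<lceil>(1 + 1 / (real p + 1)) ^ n\<rceil>. Y i \<omega>)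
      / real (nat \<lceil>(1 + 1 / (real p + 1)) ^ n\<rceil>)) \<longlonglongrightarrow> expectation (Y 0)"
    by (subst AE_all_countable, intro allI strong_law_geometric_subsequence[OF ind distr int nn]) simp
  then show ?thesis
  proof eventually_elim
    case (elim \<omega>)
    show ?case
    proof (rule mono_averages_interpolate)
      show "mono (\<lambda>n. \<Sum>i<n. Y i \<omega>)"
        by (intro monoI sum_mono2) (use nn in auto)
      show "0 \<le> expectation (Y 0)" using nn by (intro Bochner_Integration.integral_nonneg) auto
    qed (use elim in auto)
  qed
qed

text \<open>
  Positive and negative parts are again independent and identically distributed, which reduces
  Kolmogorov's strong law to nonnegative variables.
\<close>

theorem strong_law_of_large_numbers:
  fixes Y :: "nat \<Rightarrow> 'a \<Rightarrow> real"
  assumes ind: "indep_vars (\<lambda>_. borel) Y UNIV"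
    and distr: "\<And>i. distr M borel (Y i) = distr M borel (Y 0)"
    and int: "integrable M (Y 0)"
  shows "AE \<omega> in M. (\<lambda>n. (\<Sum>i<n. Y i \<omega>) / real n) \<longlonglongrightarrow> expectation (Y 0)"
proof -
  have [measurable]: "Y i \<in> borel_measurable M" for i using ind by (simp add: indep_vars_def)
  have part: "AE \<omega> in M. (\<lambda>n. (\<Sum>i<n. g (Y i \<omega>)) / real n) \<longlonglongrightarrow> expectation (\<lambda>\<omega>. g (Y 0 \<omega>))"
    if [measurable]: "g \<in> borel_measurable borel" and g: "\<And>y. 0 \<le> g y" "\<And>y. g y \<le> \<bar>y\<bar>" for g :: "real \<Rightarrow> real"
  proof (rule strong_law_nonneg)
    show "indep_vars (\<lambda>_. borel) (\<lambda>i \<omega>. g (Y i \<omega>)) UNIV"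
      by (rule indep_vars_compose2[OF ind]) simp
    show "distr M borel (\<lambda>\<omega>. g (Y i \<omega>)) = distr M borel (\<lambda>\<omega>. g (Y 0 \<omega>))" for i
      using distr_distr[of g borel borel "Y i" M] distr_distr[of g borel borel "Y 0" M] distr[of i]
      by (simp add: comp_def)
    show "integrable M (\<lambda>\<omega>. g (Y 0 \<omega>))"
      by (rule Bochner_Integration.integrable_bound[OF integrable_abs[OF int]]) (use g in auto)
  qed (use g in auto)
  have "AE \<omega> in M. (\<lambda>n. (\<Sum>i<n. max 0 (Y i \<omega>)) / real n) \<longlonglongrightarrow> expectation (\<lambda>\<omega>. max 0 (Y 0 \<omega>))"
    by (rule part) auto
  moreover have "AE \<omega> in M. (\<lambda>n. (\<Sum>i<n. max 0 (- Y i \<omega>)) / real n) \<longlonglongrightarrow> expectation (\<lambda>\<omega>. max 0 (- Y 0 \<omega>))"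
    by (rule part) auto
  ultimately show ?thesis
  proof eventually_elim
    case (elim \<omega>)
    have dec: "max 0 y - max 0 (- y) = y" for y :: real by auto
    have E: "expectation (\<lambda>\<omega>. max 0 (Y 0 \<omega>)) - expectation (\<lambda>\<omega>. max 0 (- Y 0 \<omega>)) = expectation (Y 0)"
      using int by (subst Bochner_Integration.integral_diff[symmetric]) (auto simp: dec)
    show ?case using tendsto_diff[OF elim]
      by (simp add: E dec flip: diff_divide_distrib sum_subtractf)
  qed
qed

text \<open>
  Used to shift a sequence of samples numbered from \<open>1\<close> to one numbered from \<open>0\<close>.
\<close>

lemma indep_vars_inj_reindex:
  assumes X: "indep_vars M' X I" and f: "inj_on f J" "f ` J \<subseteq> I"
  shows "indep_vars (\<lambda>j. M' (f j)) (\<lambda>j. X (f j)) J"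
proof -
  define G where "G i = {X i -` A \<inter> space M |A. A \<in> sets (M' i)}" for i
  have G: "indep_sets G I" using X by (simp add: indep_vars_def2 G_def[abs_def])
  have "indep_sets (\<lambda>j. G (f j)) J"
  proof (rule indep_setsI)
    show "G (f j) \<subseteq> events" if "j \<in> J" for j using G that f by (auto simp: indep_sets_def)
    fix A K assume K: "K \<noteq> {}" "K \<subseteq> J" "finite K" "\<forall>j\<in>K. A j \<in> G (f j)"
    have inj: "inj_on f K" using f(1) K(2) by (rule inj_on_subset)
    define A' where "A' i = A (the_inv_into K f i)" for i
    have A': "A' (f j) = A j" if "j \<in> K" for j using inj that by (simp add: A'_def the_inv_into_f_f)
    have "prob (\<Inter>i\<in>f ` K. A' i) = (\<Prod>i\<in>f ` K. prob (A' i))"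
      using K f A' by (intro indep_setsD[OF G]) auto
    then show "prob (\<Inter>j\<in>K. A j) = (\<Prod>j\<in>K. prob (A j))"
      using A' by (simp add: prod.reindex[OF inj])
  qed
  then show ?thesis using X f by (auto simp: indep_vars_def2 G_def)
qed

lemma strong_law_for_samples:
  fixes X :: "nat \<Rightarrow> 'a \<Rightarrow> 'b" and g :: "'b \<Rightarrow> real"
  assumes ind: "indep_vars (\<lambda>_. N) X {1..}"
    and distr: "\<And>i. 1 \<le> i \<Longrightarrow> distr M N (X i) = \<mu>"
    and g: "integrable \<mu> g"
  shows "AE \<omega> in M. (\<lambda>n. 1 / real n * (\<Sum>i=1..n. g (X i \<omega>))) \<longlonglongrightarrow> (\<integral>y. g y \<partial>\<mu>)"
proof -
  have X[measurable]: "X (Suc i) \<in> M \<rightarrow>\<^sub>M N" for i using ind by (simp add: indep_vars_def)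
  have sets: "sets \<mu> = sets N" using distr[of 1] by auto
  have [measurable]: "g \<in> borel_measurable N"
    using borel_measurable_integrable[OF g] measurable_cong_sets[OF sets refl] by blast
  define Y where "Y i \<omega> = g (X (Suc i) \<omega>)" for i \<omega>
  have Y_distr: "distr M borel (Y i) = distr \<mu> borel g" for i
    unfolding Y_def distr[of "Suc i", symmetric, simplified] by (subst distr_distr) (auto simp: comp_def)
  have "indep_vars (\<lambda>_. N) (\<lambda>i. X (Suc i)) UNIV"
    using indep_vars_inj_reindex[OF ind, of Suc UNIV] by auto
  then have "indep_vars (\<lambda>_. borel) Y UNIV"
    unfolding Y_def by (rule indep_vars_compose2) simp
  moreover have "integrable M (Y 0)"
    unfolding Y_def using g distr[of "Suc 0"] by (subst integrable_distr_eq[symmetric, where N=N]) auto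
  ultimately have "AE \<omega> in M. (\<lambda>n. (\<Sum>i<n. Y i \<omega>) / real n) \<longlonglongrightarrow> expectation (Y 0)"
    by (intro strong_law_of_large_numbers) (simp_all add: Y_distr)
  moreover have "expectation (Y 0) = (\<integral>y. g y \<partial>\<mu>)"
    unfolding Y_def using distr[of "Suc 0"] integral_distr[of "X (Suc 0)" M N g] by simp
  moreover have "(\<Sum>i<n. Y i \<omega>) / real n = 1 / real n * (\<Sum>i=1..n. g (X i \<omega>))" for n \<omega>
    by (simp add: Y_def sum.atLeast1_atMost_eq)
  ultimately show ?thesis by simp
qed

end

section \<open>Linear systems near a diagonal one\<close>

text \<open>
  For a square system uniqueness implies existence, through the determinant. The entries are
  indexed from \<open>1\<close> in \<open>solves_system\<close> and from \<open>0\<close> in the matrix type, hence the shifts by one.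
\<close>

lemma solves_system_exists_if_injective:
  assumes inj: "\<And>c. solves_system M A (\<lambda>_. 0) c \<Longrightarrow> \<forall>m\<in>{1..M}. c m = 0"
  shows "\<exists>c. solves_system M A b c"
proof -
  define B where "B = Matrix.mat M M (\<lambda>(i, j). A (Suc i) (Suc j))"
  have B: "B \<in> carrier_mat M M" by (simp add: B_def)
  have mult: "vec_index (B *\<^sub>v v) i = (\<Sum>l=1..M. A (Suc i) l * vec_index v (l - 1))"
    if "v \<in> carrier_vec M" "i < M" for v i
  proof -
    have "vec_index (B *\<^sub>v v) i = (\<Sum>j<M. A (Suc i) (Suc j) * vec_index v j)"
      using that by (simp add: B_def scalar_prod_def atLeast0LessThan)
    also have "\<dots> = (\<Sum>l=1..M. A (Suc i) l * vec_index v (l - 1))"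
      using sum.shift_bounds_cl_Suc_ivl[of "\<lambda>l. A (Suc i) l * vec_index v (l - 1)" 0 "M - 1"] that
      by (cases M) (simp_all add: lessThan_Suc_atMost atLeast0AtMost)
    finally show ?thesis .
  qed
  have sys: "solves_system M A d (\<lambda>l. vec_index v (l - 1)) \<longleftrightarrow> (\<forall>i<M. vec_index (B *\<^sub>v v) i = d (Suc i))"
    if v: "v \<in> carrier_vec M" for v d
  proof -
    have "{1..M} = Suc ` {..<M}" by (simp add: image_Suc_lessThan)
    then have "(\<forall>m\<in>{1..M}. Q m) \<longleftrightarrow> (\<forall>i<M. Q (Suc i))" for Q by auto
    then show ?thesis using mult[OF v] by (simp add: solves_system_def)
  qed
  have "Determinant.det B \<noteq> 0"
  proof
    assume "Determinant.det B = 0"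
    then obtain v where v: "v \<in> carrier_vec M" "v \<noteq> 0\<^sub>v M" "B *\<^sub>v v = 0\<^sub>v M"
      using det_0_iff_vec_prod_zero_field[OF B] by blast
    then have "solves_system M A (\<lambda>_. 0) (\<lambda>l. vec_index v (l - 1))"
      unfolding sys[OF v(1)] by simp
    from inj[OF this] have "vec_index v i = 0" if "i < M" for i
      using that by (auto dest!: bspec[of _ _ "Suc i"])
    then have "v = 0\<^sub>v M" using v(1) by (intro eq_vecI) auto
    with v(2) show False by simp
  qed
  then have "B \<in> Units (ring_mat TYPE(real) M ())" by (rule det_non_zero_imp_unit[OF B])
  then obtain C where C: "C \<in> carrier_mat M M" "B * C = 1\<^sub>m M"
    by (auto simp: Units_def ring_mat_simps)
  define w where "w = Matrix.vec M (\<lambda>i. b (Suc i))"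
  have w: "w \<in> carrier_vec M" by (simp add: w_def)
  have "B *\<^sub>v (C *\<^sub>v w) = w"
    using assoc_mult_mat_vec[OF B C(1) w] C(2) w by simp
  then have "solves_system M A b (\<lambda>l. vec_index (C *\<^sub>v w) (l - 1))"
    using C(1) w by (subst sys) (auto simp: w_def)
  then show ?thesis by blast
qed

text \<open>
  Row \<open>m\<close> of the perturbed system, minus the exact equation, expresses \<open>\<Lambda> m * (c m - x m)\<close>
  through the errors of the data and the unknown \<open>c\<close>. Since \<open>\<parallel>c\<parallel> \<le> \<parallel>c - x\<parallel> + \<parallel>x\<parallel>\<close> in the
  \<open>\<ell>\<^sup>1\<close> norm, a matrix error of at most \<open>\<kappa> / 2\<close> lets half of \<open>\<kappa> * \<parallel>c - x\<parallel>\<close> absorb the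
  contribution of the error.
\<close>

lemma diagonal_system_perturbation:
  fixes \<Lambda> :: "nat \<Rightarrow> real"
  assumes low: "\<And>m. m \<in> {1..M} \<Longrightarrow> \<kappa> \<le> \<Lambda> m"
    and exact: "\<And>m. m \<in> {1..M} \<Longrightarrow> \<Lambda> m * x m = b m"
    and sol: "solves_system M A b' c"
    and \<eta>: "(\<Sum>m=1..M. \<Sum>l=1..M. \<bar>A m l - (if m = l then \<Lambda> m else 0)\<bar>) \<le> \<kappa> / 2"
      (is "?\<eta> \<le> _")
  shows "\<kappa> / 2 * (\<Sum>m=1..M. \<bar>c m - x m\<bar>)
      \<le> (\<Sum>m=1..M. \<bar>b' m - b m\<bar>) + ?\<eta> * (\<Sum>m=1..M. \<bar>x m\<bar>)"
proof -
  define E where "E m l = A m l - (if m = l then \<Lambda> m else 0)" for m l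
  define D where "D = (\<Sum>m=1..M. \<bar>c m - x m\<bar>)"
  define X where "X = (\<Sum>m=1..M. \<bar>x m\<bar>)"
  define \<eta> where "\<eta> = (\<Sum>m=1..M. \<Sum>l=1..M. \<bar>E m l\<bar>)"
  have row: "\<Lambda> m * (c m - x m) = (b' m - b m) - (\<Sum>l=1..M. E m l * c l)" if m: "m \<in> {1..M}" for m
  proof -
    have "(\<Sum>l=1..M. E m l * c l) = (\<Sum>l=1..M. A m l * c l) - (\<Sum>l=1..M. (if m = l then \<Lambda> m else 0) * c l)"
      by (simp add: E_def left_diff_distrib sum_subtractf)
    also have "(\<Sum>l=1..M. A m l * c l) = b' m" using sol m by (simp add: solves_system_def)
    also have "(\<Sum>l=1..M. (if m = l then \<Lambda> m else 0) * c l) = (\<Sum>l=1..M. if m = l then \<Lambda> m * c l else 0)"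
      by (intro sum.cong) auto
    also have "\<dots> = \<Lambda> m * c m" using m by simp
    finally show ?thesis using exact[OF m] by (simp add: algebra_simps)
  qed
  have c_le: "\<bar>c l\<bar> \<le> D + X" if "l \<in> {1..M}" for l
  proof -
    have "\<bar>c l\<bar> \<le> \<bar>c l - x l\<bar> + \<bar>x l\<bar>" by linarith
    also have "\<dots> \<le> D + X"
      unfolding D_def X_def using that by (intro add_mono member_le_sum[of l]) auto
    finally show ?thesis .
  qed
  have "\<kappa> * D \<le> (\<Sum>m=1..M. \<bar>b' m - b m\<bar> + (\<Sum>l=1..M. \<bar>E m l\<bar> * (D + X)))"
    unfolding D_def[THEN arg_cong[where f="(*) \<kappa>"], unfolded sum_distrib_left]
  proof (intro sum_mono)
    fix m assume m: "m \<in> {1..M}"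
    have "\<kappa> * \<bar>c m - x m\<bar> \<le> \<Lambda> m * \<bar>c m - x m\<bar>"
      using low[OF m] by (intro mult_right_mono) auto
    also have "\<dots> \<le> \<bar>\<Lambda> m * (c m - x m)\<bar>" by (simp add: abs_mult mult_right_mono)
    also have "\<dots> \<le> \<bar>b' m - b m\<bar> + \<bar>\<Sum>l=1..M. E m l * c l\<bar>" unfolding row[OF m] by linarith
    also have "\<bar>\<Sum>l=1..M. E m l * c l\<bar> \<le> (\<Sum>l=1..M. \<bar>E m l\<bar> * \<bar>c l\<bar>)"
      using sum_abs[of "\<lambda>l. E m l * c l" "{1..M}"] by (simp add: abs_mult)
    also have "\<dots> \<le> (\<Sum>l=1..M. \<bar>E m l\<bar> * (D + X))"
      by (intro sum_mono mult_left_mono c_le) auto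
    finally show "\<kappa> * \<bar>c m - x m\<bar> \<le> \<bar>b' m - b m\<bar> + (\<Sum>l=1..M. \<bar>E m l\<bar> * (D + X))" by simp
  qed
  also have "\<dots> = (\<Sum>m=1..M. \<bar>b' m - b m\<bar>) + \<eta> * (D + X)"
    by (simp add: sum.distrib \<eta>_def sum_distrib_right)
  finally have "\<kappa> * D \<le> (\<Sum>m=1..M. \<bar>b' m - b m\<bar>) + \<eta> * D + \<eta> * X" by (simp add: algebra_simps)
  moreover have "\<eta> * D \<le> \<kappa> / 2 * D"
    using \<eta> unfolding \<eta>_def E_def D_def by (intro mult_right_mono sum_nonneg) auto
  ultimately show ?thesis by (simp add: D_def X_def \<eta>_def E_def)
qed

text \<open>
  With right-hand side and reference solution both \<open>0\<close>, the perturbation bound says that the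
  homogeneous system has only the trivial solution.
\<close>

lemma near_diagonal_system_solvable:
  fixes \<Lambda> :: "nat \<Rightarrow> real"
  assumes pos: "0 < \<kappa>" and low: "\<And>m. m \<in> {1..M} \<Longrightarrow> \<kappa> \<le> \<Lambda> m"
    and \<eta>: "(\<Sum>m=1..M. \<Sum>l=1..M. \<bar>A m l - (if m = l then \<Lambda> m else 0)\<bar>) \<le> \<kappa> / 2"
  shows "\<exists>c. solves_system M A b c"
proof (rule solves_system_exists_if_injective, intro ballI)
  fix c m assume c: "solves_system M A (\<lambda>_. 0) c" and m: "m \<in> {1..M}"
  have "\<kappa> / 2 * (\<Sum>m=1..M. \<bar>c m - 0\<bar>) \<le> 0"
    using diagonal_system_perturbation[OF low _ c \<eta>, of "\<lambda>_. 0" "\<lambda>_. 0"] by simp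
  then have "(\<Sum>m=1..M. \<bar>c m\<bar>) \<le> 0" using pos by (simp add: mult_le_0_iff)
  moreover have "\<bar>c m\<bar> \<le> (\<Sum>m=1..M. \<bar>c m\<bar>)" using m by (intro member_le_sum) auto
  ultimately show "c m = 0" by simp
qed

text \<open>
  Existence of a solution is an uncountable union over \<open>c\<close>, which has to be made countable.
  A solution can be taken to lie in a compact cube \<open>{- k..k}\<close> for some \<open>k\<close>. On a compact set the
  continuous residual has a zero iff its infimum is \<open>0\<close>, and the infimum may be tested on a
  countable dense set of vectors.
\<close>

lemma solvability_measurable:
  fixes A :: "'w \<Rightarrow> nat \<Rightarrow> nat \<Rightarrow> real" and b :: "'w \<Rightarrow> nat \<Rightarrow> real"
  assumes [measurable]: "\<And>m l. (\<lambda>\<omega>. A \<omega> m l) \<in> borel_measurable P" "\<And>m. (\<lambda>\<omega>. b \<omega> m) \<in> borel_measurable P"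
  shows "{\<omega>\<in>space P. \<exists>c. solves_system M (A \<omega>) (b \<omega>) c} \<in> sets P"
proof -
  define F where "F \<omega> c = (\<Sum>m=1..M. \<bar>(\<Sum>l=1..M. A \<omega> m l * c l) - b \<omega> m\<bar>)" for \<omega> and c :: "nat \<Rightarrow> real"
  \<comment> \<open>Clamping to the cube: it carries a dense subset of the whole space to one of the cube.\<close>
  define r where "r k c i = max (- real k) (min (real k) (c i))" for k and c :: "nat \<Rightarrow> real" and i :: nat
  have F_iff: "solves_system M (A \<omega>) (b \<omega>) c \<longleftrightarrow> F \<omega> c = 0" for \<omega> c
    unfolding F_def solves_system_def by (subst sum_nonneg_eq_0_iff) auto
  have F_nn: "0 \<le> F \<omega> c" for \<omega> c unfolding F_def by (intro sum_nonneg) auto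
  have [measurable]: "(\<lambda>\<omega>. F \<omega> c) \<in> borel_measurable P" for c unfolding F_def by measurable
  have coord: "continuous_on UNIV (\<lambda>c::nat \<Rightarrow> real. c i)" for i
    by (rule continuous_on_product_coordinates)
  have F_cont: "continuous_on UNIV (F \<omega>)" for \<omega>
    unfolding F_def by (intro continuous_on_sum continuous_on_rabs continuous_on_diff continuous_on_mult continuous_on_const coord)
  have r_cont: "continuous_on UNIV (r k)" for k
    unfolding r_def
    by (intro continuous_on_coordinatewise_then_product continuous_on_max continuous_on_min continuous_on_const coord)
  define K where "K k = PiE UNIV (\<lambda>_::nat. {- real k..real k})" for k
  have K_compact: "compact (K k)" for k
    using compactin_PiE[of "\<lambda>_. euclidean" UNIV "\<lambda>_::nat. {- real k..real k}"]
    unfolding K_def euclidean_product_topology compactin_euclidean_iff by (simp only:) auto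
  have r_K: "r k c \<in> K k" for k c unfolding K_def r_def by auto
  have K_r: "r k c = c" if "c \<in> K k" for k c
    using that unfolding K_def r_def by (auto simp: fun_eq_iff PiE_iff max_def min_def intro: antisym)
  obtain D :: "(nat \<Rightarrow> real) set" where D: "countable D" "\<And>U. open U \<Longrightarrow> U \<noteq> {} \<Longrightarrow> \<exists>d\<in>D. d \<in> U"
    using countable_dense_exists by blast
  have iff: "(\<exists>c. solves_system M (A \<omega>) (b \<omega>) c)
      \<longleftrightarrow> (\<exists>k. \<forall>n. \<exists>d\<in>D. F \<omega> (r k d) < inverse (real (Suc n)))" for \<omega>
  proof
    assume "\<exists>c. solves_system M (A \<omega>) (b \<omega>) c"
    then obtain c where c: "F \<omega> c = 0" by (auto simp: F_iff)
    \<comment> \<open>Entries outside \<open>{1..M}\<close> are arbitrary, possibly unbounded, and have to be reset.\<close>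
    define c' where "c' i = (if i \<in> {1..M} then c i else 0)" for i
    have c': "F \<omega> c' = 0" using c by (simp add: F_def c'_def)
    obtain k where k: "(\<Sum>i=1..M. \<bar>c i\<bar>) \<le> real k" using real_arch_simple by blast
    have "c' \<in> K k"
    proof -
      have "\<bar>c' i\<bar> \<le> real k" for i
      proof (cases "i \<in> {1..M}")
        case True
        then have "\<bar>c i\<bar> \<le> (\<Sum>i=1..M. \<bar>c i\<bar>)" by (intro member_le_sum) auto
        with k True show ?thesis by (simp add: c'_def)
      qed (auto simp: c'_def)
      then show ?thesis unfolding K_def by (auto simp: PiE_iff abs_le_iff minus_le_iff)
    qed
    then have zero: "F \<omega> (r k c') = 0" using K_r c' by simp
    have "\<exists>d\<in>D. F \<omega> (r k d) < inverse (real (Suc n))" for n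
    proof -
      have "continuous_on UNIV (\<lambda>d. F \<omega> (r k d))"
        using continuous_on_compose2[OF F_cont r_cont] by simp
      then have op: "open {d. F \<omega> (r k d) < inverse (real (Suc n))}"
        by (intro open_Collect_less continuous_on_const)
      have ne: "{d. F \<omega> (r k d) < inverse (real (Suc n))} \<noteq> {}"
        using zero by (auto intro!: exI[of _ c'])
      show ?thesis using D(2)[OF op ne] by simp
    qed
    then show "\<exists>k. \<forall>n. \<exists>d\<in>D. F \<omega> (r k d) < inverse (real (Suc n))" by blast
  next
    assume "\<exists>k. \<forall>n. \<exists>d\<in>D. F \<omega> (r k d) < inverse (real (Suc n))"
    then obtain k where k: "\<And>n. \<exists>d\<in>D. F \<omega> (r k d) < inverse (real (Suc n))" by blast
    obtain c where c: "\<And>y. y \<in> K k \<Longrightarrow> F \<omega> c \<le> F \<omega> y"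
      using continuous_attains_inf[OF K_compact, of k "F \<omega>"] r_K continuous_on_subset[OF F_cont]
      by (metis empty_iff subset_UNIV)
    have "\<not> 0 < F \<omega> c"
    proof
      assume "0 < F \<omega> c"
      then obtain n where "inverse (real (Suc n)) < F \<omega> c" using reals_Archimedean by blast
      moreover obtain d where "F \<omega> (r k d) < inverse (real (Suc n))" using k by blast
      ultimately show False using c[OF r_K, of d] by linarith
    qed
    then show "\<exists>c. solves_system M (A \<omega>) (b \<omega>) c" using F_nn[of \<omega> c] by (auto simp: F_iff)
  qed
  have "{\<omega>\<in>space P. \<exists>k. \<forall>n. \<exists>d\<in>D. F \<omega> (r k d) < inverse (real (Suc n))} \<in> sets P"
    using D(1) by measurable
  then show ?thesis by (simp add: iff)
qed

section \<open>Orthonormal expansions\<close>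

lemma L2_mult_integrable:
  assumes "f \<in> L2 \<mu>" "g \<in> L2 \<mu>"
  shows "integrable \<mu> (\<lambda>x. f x * g x)"
proof (rule Bochner_Integration.integrable_bound[where f="\<lambda>x. (f x)\<^sup>2 + (g x)\<^sup>2"])
  have "\<bar>a * b\<bar> \<le> a\<^sup>2 + b\<^sup>2" for a b :: real
    using sum_squares_bound[of "\<bar>a\<bar>" "\<bar>b\<bar>"] mult_nonneg_nonneg[of "\<bar>a\<bar>" "\<bar>b\<bar>"]
    by (simp add: abs_mult del: mult_nonneg_nonneg)
  then show "AE x in \<mu>. norm (f x * g x) \<le> norm ((f x)\<^sup>2 + (g x)\<^sup>2)" by simp
qed (use assms in \<open>auto simp: L2_def\<close>)

lemma L2_add:
  assumes "f \<in> L2 \<mu>" "g \<in> L2 \<mu>"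
  shows "(\<lambda>x. f x + g x) \<in> L2 \<mu>"
  using assms L2_mult_integrable[OF assms] by (auto simp: L2_def power2_sum mult.assoc)

lemma L2_cmult:
  assumes "f \<in> L2 \<mu>"
  shows "(\<lambda>x. c * f x) \<in> L2 \<mu>"
  using assms by (auto simp: L2_def power_mult_distrib)

lemma L2_sum:
  assumes "\<And>m. m \<in> F \<Longrightarrow> f m \<in> L2 \<mu>"
  shows "(\<lambda>x. \<Sum>m\<in>F. f m x) \<in> L2 \<mu>"
  using assms by (induction F rule: infinite_finite_induct) (auto simp: L2_add, auto simp: L2_def)

lemma L2_inner_sum_left:
  assumes e: "\<And>m. m \<in> F \<Longrightarrow> e m \<in> L2 \<mu>" and g: "g \<in> L2 \<mu>"
  shows "L2_inner \<mu> (\<lambda>x. \<Sum>m\<in>F. c m * e m x) g = (\<Sum>m\<in>F. c m * L2_inner \<mu> (e m) g)"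
proof -
  have "L2_inner \<mu> (\<lambda>x. \<Sum>m\<in>F. c m * e m x) g = (\<integral>x. (\<Sum>m\<in>F. c m * (e m x * g x)) \<partial>\<mu>)"
    by (simp add: L2_inner_def sum_distrib_right mult.assoc)
  also have "\<dots> = (\<Sum>m\<in>F. c m * L2_inner \<mu> (e m) g)"
    unfolding L2_inner_def using L2_mult_integrable[OF e g]
    by (subst Bochner_Integration.integral_sum) auto
  finally show ?thesis .
qed

lemma L2_inner_commute: "L2_inner \<mu> f g = L2_inner \<mu> g f"
  by (simp add: L2_inner_def mult.commute)

lemma L2_norm_square: "(L2_norm \<mu> f)\<^sup>2 = L2_inner \<mu> f f"
  unfolding L2_norm_def L2_inner_def by simp

lemma L2_norm_nonneg: "0 \<le> L2_norm \<mu> f"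
  unfolding L2_norm_def L2_inner_def by simp

lemma L2_inner_self_diff:
  assumes "f \<in> L2 \<mu>" "g \<in> L2 \<mu>"
  shows "L2_inner \<mu> (\<lambda>x. f x - g x) (\<lambda>x. f x - g x)
    = L2_inner \<mu> f f - 2 * L2_inner \<mu> f g + L2_inner \<mu> g g"
proof -
  have "L2_inner \<mu> (\<lambda>x. f x - g x) (\<lambda>x. f x - g x) = (\<integral>x. f x * f x - 2 * (f x * g x) + g x * g x \<partial>\<mu>)"
    unfolding L2_inner_def by (intro Bochner_Integration.integral_cong) (auto simp: algebra_simps)
  then show ?thesis
    using L2_mult_integrable[OF assms(1,1)] L2_mult_integrable[OF assms] L2_mult_integrable[OF assms(2,2)]
    by (simp add: L2_inner_def)
qed

text \<open>
  Pythagoras: the combination differs from the orthogonal projection of \<open>f\<close> within the span, and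
  \<open>f\<close> minus its projection is orthogonal to the span.
\<close>

lemma orthonormal_best_approximation:
  assumes e: "\<And>m. m \<in> F \<Longrightarrow> e m \<in> L2 \<mu>" and f: "f \<in> L2 \<mu>" and F: "finite F"
    and orth: "\<And>m l. m \<in> F \<Longrightarrow> l \<in> F \<Longrightarrow> L2_inner \<mu> (e m) (e l) = (if m = l then 1 else 0)"
  shows "(L2_norm \<mu> (\<lambda>x. (\<Sum>m\<in>F. c m * e m x) - f x))\<^sup>2
    = (\<Sum>m\<in>F. (c m - L2_inner \<mu> f (e m))\<^sup>2) + ((L2_norm \<mu> f)\<^sup>2 - (\<Sum>m\<in>F. (L2_inner \<mu> f (e m))\<^sup>2))"
proof -
  define g where "g x = (\<Sum>m\<in>F. c m * e m x)" for x
  have gL: "g \<in> L2 \<mu>" unfolding g_def by (intro L2_sum L2_cmult e)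
  have gf: "L2_inner \<mu> g f = (\<Sum>m\<in>F. c m * L2_inner \<mu> f (e m))"
    using L2_inner_sum_left[OF e f, where F=F and c=c]
    by (simp only: g_def[abs_def] L2_inner_commute[of \<mu> f])
  have ge: "L2_inner \<mu> g (e l) = c l" if l: "l \<in> F" for l
  proof -
    have "L2_inner \<mu> g (e l) = (\<Sum>m\<in>F. c m * L2_inner \<mu> (e m) (e l))"
      using L2_inner_sum_left[OF e e[OF l], where F=F and c=c] by (simp add: g_def[abs_def])
    also have "\<dots> = (\<Sum>m\<in>F. if m = l then c m else 0)"
      using l by (intro sum.cong) (auto simp: orth)
    also have "\<dots> = c l" using l F by simp
    finally show ?thesis .
  qed
  have gg: "L2_inner \<mu> g g = (\<Sum>m\<in>F. (c m)\<^sup>2)"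
  proof -
    have "L2_inner \<mu> g g = (\<Sum>m\<in>F. c m * L2_inner \<mu> (e m) g)"
      using L2_inner_sum_left[OF e gL, where F=F and c=c] by (simp add: g_def[abs_def])
    also have "\<dots> = (\<Sum>m\<in>F. (c m)\<^sup>2)"
    proof (intro sum.cong refl)
      fix m assume "m \<in> F"
      from ge[OF this] show "c m * L2_inner \<mu> (e m) g = (c m)\<^sup>2"
        by (subst L2_inner_commute) (simp add: power2_eq_square)
    qed
    finally show ?thesis .
  qed
  show ?thesis
    unfolding L2_norm_square g_def[symmetric]
    by (simp add: L2_inner_self_diff[OF gL f] gf gg power2_diff sum.distrib sum_subtractf sum_distrib_left mult.assoc)
qed

text \<open>
  The partial sums of the squared coefficients fall short of \<open>(L2_norm \<mu> f)\<^sup>2\<close> by exactly the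
  squared error of the partial expansions, which tends to \<open>0\<close> by completeness.
\<close>

lemma orthonormal_basis_parseval:
  assumes onb: "L2_orthonormal_basis \<mu> e" and f: "f \<in> L2 \<mu>"
  shows "(\<lambda>m. (L2_inner \<mu> f (e m))\<^sup>2) sums (L2_norm \<mu> f)\<^sup>2"
proof -
  from onb have e: "\<And>m. e m \<in> L2 \<mu>"
    and orth: "\<And>m l. L2_inner \<mu> (e m) (e l) = (if m = l then 1 else 0)"
    and lim: "(\<lambda>n. L2_norm \<mu> (\<lambda>x. f x - (\<Sum>m<n. L2_inner \<mu> f (e m) * e m x))) \<longlonglongrightarrow> 0"
    using f by (auto simp: L2_orthonormal_basis_def)
  have swap: "L2_norm \<mu> (\<lambda>x. f x - g x) = L2_norm \<mu> (\<lambda>x. g x - f x)" for g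
    by (simp add: L2_norm_def L2_inner_def algebra_simps)
  have rem: "(L2_norm \<mu> (\<lambda>x. f x - (\<Sum>m<n. L2_inner \<mu> f (e m) * e m x)))\<^sup>2
      = (L2_norm \<mu> f)\<^sup>2 - (\<Sum>m<n. (L2_inner \<mu> f (e m))\<^sup>2)" for n
    unfolding swap using orthonormal_best_approximation[OF e f, where F="{..<n}" and c="\<lambda>m. L2_inner \<mu> f (e m)"]
    by (simp add: orth)
  have "(\<lambda>n. (L2_norm \<mu> f)\<^sup>2
      - (L2_norm \<mu> (\<lambda>x. f x - (\<Sum>m<n. L2_inner \<mu> f (e m) * e m x)))\<^sup>2) \<longlonglongrightarrow> (L2_norm \<mu> f)\<^sup>2 - 0\<^sup>2"
    by (intro tendsto_diff tendsto_power lim tendsto_const)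
  then show ?thesis by (simp add: sums_def rem)
qed

text \<open>
  The left-hand side is the sum of the squared coefficients of \<open>\<phi>\<close> beyond \<open>M\<close>, the zeroth being \<open>0\<close>. There
  \<open>(lam M)\<^sup>2\<close> times such a square is at most the corresponding squared coefficient of \<open>h\<close>, and
  all of those sum to \<open>(L2_norm \<mu> h)\<^sup>2\<close>.
\<close>

lemma spectral_truncation_error:
  assumes onb: "L2_orthonormal_basis \<mu> e" and h: "h \<in> L2 \<mu>" and \<phi>: "\<phi> \<in> L2 \<mu>"
    and coeff: "\<And>m. 1 \<le> m \<Longrightarrow> lam m * L2_inner \<mu> \<phi> (e m) = L2_inner \<mu> h (e m)"
    and mean: "L2_inner \<mu> \<phi> (e 0) = 0"
    and lamM: "0 < lam M" and mono: "\<And>m. M \<le> m \<Longrightarrow> lam M \<le> lam m"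
  shows "(L2_norm \<mu> \<phi>)\<^sup>2 - (\<Sum>m=1..M. (L2_inner \<mu> \<phi> (e m))\<^sup>2) \<le> (1 / lam M * L2_norm \<mu> h)\<^sup>2"
proof -
  define a where "a m = (if m \<in> {1..M} then 0 else (L2_inner \<mu> \<phi> (e m))\<^sup>2)" for m
  have "(\<lambda>m. (L2_inner \<mu> \<phi> (e m))\<^sup>2 - (if m \<in> {1..M} then (L2_inner \<mu> \<phi> (e m))\<^sup>2 else 0))
      sums ((L2_norm \<mu> \<phi>)\<^sup>2 - (\<Sum>m=1..M. (L2_inner \<mu> \<phi> (e m))\<^sup>2))"
    by (intro sums_diff orthonormal_basis_parseval[OF onb \<phi>] sums_If_finite_set) simp
  then have tail: "a sums ((L2_norm \<mu> \<phi>)\<^sup>2 - (\<Sum>m=1..M. (L2_inner \<mu> \<phi> (e m))\<^sup>2))"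
    by (rule back_subst[of "\<lambda>u. u sums _"]) (auto simp: a_def)
  have bound: "(\<lambda>m. (1 / lam M)\<^sup>2 * (L2_inner \<mu> h (e m))\<^sup>2) sums ((1 / lam M)\<^sup>2 * (L2_norm \<mu> h)\<^sup>2)"
    by (intro sums_mult orthonormal_basis_parseval[OF onb h])
  have "a m \<le> (1 / lam M)\<^sup>2 * (L2_inner \<mu> h (e m))\<^sup>2" for m
  proof (cases "m = 0 \<or> m \<in> {1..M}")
    case True
    then show ?thesis using mean by (auto simp: a_def)
  next
    case False
    then have m: "1 \<le> m" "M \<le> m" by auto
    have "a m = (1 / lam M)\<^sup>2 * (lam M * L2_inner \<mu> \<phi> (e m))\<^sup>2"
      using False lamM by (auto simp: a_def power_mult_distrib power_divide)
    also have "\<dots> \<le> (1 / lam M)\<^sup>2 * (lam m * L2_inner \<mu> \<phi> (e m))\<^sup>2"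
      using mono[OF m(2)] lamM
      by (intro mult_left_mono) (auto simp: power_mult_distrib intro!: mult_right_mono power_mono)
    finally show ?thesis unfolding coeff[OF m(1)] .
  qed
  from sums_le[OF this tail bound] show ?thesis unfolding power_mult_distrib .
qed

section \<open>Convergence of the empirical Galerkin approximation\<close>

theorem proposition1:
  fixes \<rho> :: "real ^ 'd::finite \<Rightarrow> real"
    and \<mu> :: "(real ^ 'd) measure"
    and h \<phi> :: "real ^ 'd \<Rightarrow> real"
    and D\<phi> :: "real ^ 'd \<Rightarrow> real ^ 'd"
    and lam :: "nat \<Rightarrow> real"
    and e :: "nat \<Rightarrow> real ^ 'd \<Rightarrow> real"
    and De :: "nat \<Rightarrow> real ^ 'd \<Rightarrow> real ^ 'd"
    and P :: "'w measure"
    and X :: "nat \<Rightarrow> 'w \<Rightarrow> real ^ 'd"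
    and M :: nat
  assumes A1: "assumption_A1 \<rho>"
    and mu: "\<mu> = density lborel (\<lambda>x. ennreal (\<rho> x))"
    and mu_prob: "prob_space \<mu>"
    and A2: "assumption_A2 \<mu> h"
    and phi: "poisson_weak_solution \<mu> h \<phi> D\<phi>"
    and lam0: "lam 0 = 0" and lam1: "0 < lam 1"
    and lam_mono: "\<And>m. lam m \<le> lam (Suc m)"
    and eigen: "\<And>m. neg_laplacian_eigenfunction \<mu> (lam m) (e m) (De m)"
    and e0: "e 0 = (\<lambda>x. 1)"
    and onb: "L2_orthonormal_basis \<mu> e"
    and P: "prob_space P"
    and X_indep: "prob_space.indep_vars P (\<lambda>i. borel) X {1..}"
    and X_distr: "\<And>i. 1 \<le> i \<Longrightarrow> distr P borel (X i) = \<mu>"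
    and M: "1 \<le> M"
  shows
    "(\<lambda>N. measure P {\<omega> \<in> space P.
        \<exists>c. solves_system M (empirical_matrix X De N \<omega>) (empirical_vector X h e N \<omega>) c})
       \<longlonglongrightarrow> 1
     \<and>
     (\<forall>c :: nat \<Rightarrow> 'w \<Rightarrow> nat \<Rightarrow> real.
        (\<forall>N\<ge>1. \<forall>m\<in>{1..M}. (\<lambda>\<omega>. c N \<omega> m) \<in> borel_measurable P) \<and>
        (\<forall>N\<ge>1. \<forall>\<omega>\<in>space P.
           (\<exists>c'. solves_system M (empirical_matrix X De N \<omega>) (empirical_vector X h e N \<omega>) c') \<longrightarrow>
           solves_system M (empirical_matrix X De N \<omega>) (empirical_vector X h e N \<omega>) (c N \<omega>))
        \<longrightarrow>
        (\<exists>\<epsilon> :: nat \<Rightarrow> 'w \<Rightarrow> real.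
           (\<forall>N. \<epsilon> N \<in> borel_measurable P) \<and>
           (AE \<omega> in P. (\<lambda>N. \<epsilon> N \<omega>) \<longlonglongrightarrow> 0) \<and>
           (\<forall>N\<ge>1. \<forall>\<omega>\<in>space P.
              (\<exists>c'. solves_system M (empirical_matrix X De N \<omega>) (empirical_vector X h e N \<omega>) c') \<longrightarrow>
              L2_norm \<mu> (\<lambda>x. galerkin_approx M e (c N \<omega>) x - \<phi> x)
                \<le> 1 / lam M * L2_norm \<mu> h + \<epsilon> N \<omega>)))"
proof -
  interpret P: prob_space P by (rule P)
  have sets_mu: "sets \<mu> = sets borel" by (simp add: mu)
  have eL: "e m \<in> L2 \<mu>" and orth: "L2_inner \<mu> (e m) (e l) = (if m = l then 1 else 0)" for m l
    using onb by (auto simp: L2_orthonormal_basis_def)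
  have hL: "h \<in> L2 \<mu>" using A2 by (simp add: assumption_A2_def)
  have phi_H1: "H1_0 \<mu> \<phi> D\<phi>"
    and weak: "\<And>\<psi> E. H1_0 \<mu> \<psi> E \<Longrightarrow> grad_inner \<mu> D\<phi> E = L2_inner \<mu> h \<psi>"
    using phi by (auto simp: poisson_weak_solution_def)
  have phiL: "\<phi> \<in> L2 \<mu>" using phi_H1 by (simp add: H1_0_def H1_def)
  have eH1: "H1 \<mu> (e m) (De m)" for m
    using eigen[of m] by (simp add: neg_laplacian_eigenfunction_def has_weighted_laplacian_def)
  have eig: "grad_inner \<mu> (De m) E = lam m * L2_inner \<mu> (e m) \<psi>" if "H1 \<mu> \<psi> E" for m \<psi> E
    using eigen[of m] that
    by (simp add: neg_laplacian_eigenfunction_def has_weighted_laplacian_def L2_inner_def mult.assoc)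
  have DeL: "(\<lambda>x. De m x $ i) \<in> L2 \<mu>" for m i using eH1 by (simp add: H1_def)
  have lam_mono': "lam m \<le> lam l" if "m \<le> l" for m l
    using that by (rule lift_Suc_mono_le[of lam, OF lam_mono])
  \<comment> \<open>Orthogonality to the constant \<open>e 0\<close>, which makes \<open>e m\<close> an admissible test function.\<close>
  have e_mean: "(\<integral>x. e m x \<partial>\<mu>) = 0" if "1 \<le> m" for m
    using orth[of m 0] that by (simp add: L2_inner_def e0)
  have coeff: "lam m * L2_inner \<mu> \<phi> (e m) = L2_inner \<mu> h (e m)" if "1 \<le> m" for m
  proof -
    have "L2_inner \<mu> h (e m) = grad_inner \<mu> D\<phi> (De m)"
      using weak[of "e m" "De m"] eH1 e_mean[OF that] by (simp add: H1_0_def)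
    also have "\<dots> = grad_inner \<mu> (De m) D\<phi>" by (simp add: grad_inner_def inner_commute)
    also have "\<dots> = lam m * L2_inner \<mu> \<phi> (e m)"
      using phi_H1 by (subst eig[of \<phi>]) (auto simp: H1_0_def L2_inner_commute[of \<mu> \<phi>])
    finally show ?thesis by simp
  qed

  define x where "x m = L2_inner \<mu> \<phi> (e m)" for m
  define \<beta> where "\<beta> m = L2_inner \<mu> h (e m)" for m
  define \<eta> where "\<eta> N \<omega> = (\<Sum>m=1..M. \<Sum>l=1..M.
      \<bar>empirical_matrix X De N \<omega> m l - (if m = l then lam m else 0)\<bar>)" for N \<omega>
  define \<delta> where "\<delta> N \<omega> = (\<Sum>m=1..M. \<bar>empirical_vector X h e N \<omega> m - \<beta> m\<bar>)" for N \<omega>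
  define S where "S N = {\<omega> \<in> space P.
      \<exists>c. solves_system M (empirical_matrix X De N \<omega>) (empirical_vector X h e N \<omega>) c}" for N

  have gradL1: "integrable \<mu> (\<lambda>y. De l y \<bullet> De m y)" for m l
    unfolding inner_vec_def using L2_mult_integrable[OF DeL DeL] by simp
  have heL1: "integrable \<mu> (\<lambda>y. h y * e m y)" for m by (rule L2_mult_integrable[OF hL eL])
  have [measurable]: "X i \<in> borel_measurable P" if "1 \<le> i" for i
    using X_indep that by (simp add: P.indep_vars_def)
  have average_measurable: "(\<lambda>\<omega>. 1 / real N * (\<Sum>i=1..N. g (X i \<omega>))) \<in> borel_measurable P"
    if "integrable \<mu> g" for g :: "real ^ 'd \<Rightarrow> real" and N
  proof -
    have [measurable]: "g \<in> borel_measurable borel"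
      using borel_measurable_integrable[OF that] measurable_cong_sets[OF sets_mu refl] by blast
    show ?thesis by measurable
  qed
  have S_sets [measurable]: "S N \<in> sets P" for N
    unfolding S_def empirical_matrix_def empirical_vector_def
    by (intro solvability_measurable average_measurable gradL1 heL1)

  have lln: "AE \<omega> in P. (\<lambda>N. 1 / real N * (\<Sum>i=1..N. g (X i \<omega>))) \<longlonglongrightarrow> (\<integral>y. g y \<partial>\<mu>)"
    if "integrable \<mu> g" for g :: "real ^ 'd \<Rightarrow> real"
    by (rule P.strong_law_for_samples[OF X_indep X_distr that])
  have matrix_lim: "AE \<omega> in P. (\<lambda>N. empirical_matrix X De N \<omega> m l) \<longlonglongrightarrow> (if m = l then lam m else 0)" for m l
    using lln[OF gradL1[of l m]] eig[OF eH1[of m], of l]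
    unfolding empirical_matrix_def grad_inner_def[symmetric] by (auto simp: orth)
  have vector_lim: "AE \<omega> in P. (\<lambda>N. empirical_vector X h e N \<omega> m) \<longlonglongrightarrow> \<beta> m" for m
    using lln[OF heL1[of m]] unfolding empirical_vector_def \<beta>_def L2_inner_def .
  have "AE \<omega> in P. \<forall>m l. (\<lambda>N. empirical_matrix X De N \<omega> m l) \<longlonglongrightarrow> (if m = l then lam m else 0)"
    unfolding AE_all_countable using matrix_lim by blast
  then have \<eta>_lim: "AE \<omega> in P. (\<lambda>N. \<eta> N \<omega>) \<longlonglongrightarrow> 0"
  proof eventually_elim
    case (elim \<omega>)
    have "(\<lambda>N. \<eta> N \<omega>) \<longlonglongrightarrow> (\<Sum>m=1..M. \<Sum>l=1..M. \<bar>(if m = l then lam m else 0) - (if m = l then lam m else 0)\<bar>)"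
      unfolding \<eta>_def using elim by (intro tendsto_sum tendsto_rabs tendsto_diff tendsto_const) blast
    then show ?case by simp
  qed
  have "AE \<omega> in P. \<forall>m. (\<lambda>N. empirical_vector X h e N \<omega> m) \<longlonglongrightarrow> \<beta> m"
    unfolding AE_all_countable using vector_lim by blast
  then have \<delta>_lim: "AE \<omega> in P. (\<lambda>N. \<delta> N \<omega>) \<longlonglongrightarrow> 0"
  proof eventually_elim
    case (elim \<omega>)
    have "(\<lambda>N. \<delta> N \<omega>) \<longlonglongrightarrow> (\<Sum>m=1..M. \<bar>\<beta> m - \<beta> m\<bar>)"
      unfolding \<delta>_def using elim by (intro tendsto_sum tendsto_rabs tendsto_diff tendsto_const) blast
    then show ?case by simp
  qed

  have low: "lam 1 \<le> lam m" if "m \<in> {1..M}" for m using that by (intro lam_mono') auto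
  have ev: "AE \<omega> in P. \<forall>\<^sub>F N in sequentially. \<eta> N \<omega> \<le> lam 1 / 2"
    using \<eta>_lim
  proof eventually_elim
    case (elim \<omega>)
    have "0 < lam 1 / 2" using lam1 by simp
    from order_tendstoD(2)[OF elim this] show ?case by (rule eventually_mono) simp
  qed
  have solvable: "AE \<omega> in P. \<forall>\<^sub>F N in sequentially. \<omega> \<in> S N"
    using ev AE_space
  proof eventually_elim
    case (elim \<omega>)
    from elim(1) show ?case
    proof eventually_elim
      case (elim N)
      then show ?case using \<open>\<omega> \<in> space P\<close> near_diagonal_system_solvable[OF lam1 low, where M=M and A="empirical_matrix X De N \<omega>"]
        by (simp add: S_def \<eta>_def)
    qed
  qed
  have prob_lim: "(\<lambda>N. measure P (S N)) \<longlonglongrightarrow> 1"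
  proof -
    have "(\<lambda>N. \<integral>\<omega>. indicator (S N) \<omega> \<partial>P) \<longlonglongrightarrow> (\<integral>\<omega>. (1::real) \<partial>P)"
    proof (rule integral_dominated_convergence[where w="\<lambda>_. 1"])
      show "AE \<omega> in P. (\<lambda>N. indicator (S N) \<omega> :: real) \<longlonglongrightarrow> 1"
        using solvable
      proof eventually_elim
        case (elim \<omega>)
        then have "\<forall>\<^sub>F N in sequentially. (indicator (S N) \<omega> :: real) = 1"
          by eventually_elim simp
        then show ?case by (rule tendsto_eventually)
      qed
    qed (auto simp: indicator_def)
    then show ?thesis by (simp add: P.prob_space)
  qed

  have main: "\<exists>\<epsilon> :: nat \<Rightarrow> 'w \<Rightarrow> real.
      (\<forall>N. \<epsilon> N \<in> borel_measurable P) \<and>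
      (AE \<omega> in P. (\<lambda>N. \<epsilon> N \<omega>) \<longlonglongrightarrow> 0) \<and>
      (\<forall>N\<ge>1. \<forall>\<omega>\<in>space P.
         (\<exists>c'. solves_system M (empirical_matrix X De N \<omega>) (empirical_vector X h e N \<omega>) c') \<longrightarrow>
         L2_norm \<mu> (\<lambda>y. galerkin_approx M e (c N \<omega>) y - \<phi> y)
           \<le> 1 / lam M * L2_norm \<mu> h + \<epsilon> N \<omega>)"
    if c_meas: "\<forall>N\<ge>1. \<forall>m\<in>{1..M}. (\<lambda>\<omega>. c N \<omega> m) \<in> borel_measurable P"
      and c_sol: "\<forall>N\<ge>1. \<forall>\<omega>\<in>space P.
           (\<exists>c'. solves_system M (empirical_matrix X De N \<omega>) (empirical_vector X h e N \<omega>) c') \<longrightarrow>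
           solves_system M (empirical_matrix X De N \<omega>) (empirical_vector X h e N \<omega>) (c N \<omega>)"
    for c :: "nat \<Rightarrow> 'w \<Rightarrow> nat \<Rightarrow> real"
  proof -
    \<comment> \<open>Where the system is unsolvable, \<open>c N\<close> is only known to be measurable and may be arbitrary;
      setting \<open>\<epsilon> N\<close> to \<open>0\<close> there keeps it measurable, and almost surely this concerns only finitely many \<open>N\<close>.\<close>
    define \<epsilon> where "\<epsilon> N \<omega> = (if 1 \<le> N then indicator (S N) \<omega> * (\<Sum>m=1..M. \<bar>c N \<omega> m - x m\<bar>) else 0)" for N \<omega>
    have "\<epsilon> N \<in> borel_measurable P" for N
    proof (cases "1 \<le> N")
      case True
      have "(\<lambda>\<omega>. \<Sum>m=1..M. \<bar>c N \<omega> m - x m\<bar>) \<in> borel_measurable P"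
        using c_meas True by (intro borel_measurable_sum borel_measurable_abs borel_measurable_diff) auto
      with True show ?thesis unfolding \<epsilon>_def[abs_def] by simp
    qed (simp add: \<epsilon>_def[abs_def])
    moreover have "AE \<omega> in P. (\<lambda>N. \<epsilon> N \<omega>) \<longlonglongrightarrow> 0"
      using \<eta>_lim \<delta>_lim ev
    proof eventually_elim
      case (elim \<omega>)
      define u where "u N = 2 / lam 1 * (\<delta> N \<omega> + \<eta> N \<omega> * (\<Sum>m=1..M. \<bar>x m\<bar>))" for N
      have "u \<longlonglongrightarrow> 2 / lam 1 * (0 + 0 * (\<Sum>m=1..M. \<bar>x m\<bar>))"
        unfolding u_def by (intro tendsto_mult tendsto_add elim tendsto_const)
      then have u_lim: "u \<longlonglongrightarrow> 0" by simp
      show ?case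
      proof (rule tendsto_sandwich[OF _ _ tendsto_const u_lim])
        show "\<forall>\<^sub>F N in sequentially. 0 \<le> \<epsilon> N \<omega>"
          by (intro always_eventually allI) (auto simp: \<epsilon>_def intro!: mult_nonneg_nonneg sum_nonneg)
        show "\<forall>\<^sub>F N in sequentially. \<epsilon> N \<omega> \<le> u N"
          using elim(3)
        proof eventually_elim
          case (elim N)
          have \<delta>0: "0 \<le> \<delta> N \<omega>" and \<eta>0: "0 \<le> \<eta> N \<omega>" unfolding \<delta>_def \<eta>_def by (intro sum_nonneg; simp)+
          show ?case
          proof (cases "1 \<le> N \<and> \<omega> \<in> S N")
            case True
            then have sol: "solves_system M (empirical_matrix X De N \<omega>) (empirical_vector X h e N \<omega>) (c N \<omega>)"
              using c_sol by (auto simp: S_def)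
            have ex: "lam m * x m = \<beta> m" if "m \<in> {1..M}" for m
              using coeff[of m] that by (simp add: x_def \<beta>_def)
            have "lam 1 / 2 * (\<Sum>m=1..M. \<bar>c N \<omega> m - x m\<bar>) \<le> \<delta> N \<omega> + \<eta> N \<omega> * (\<Sum>m=1..M. \<bar>x m\<bar>)"
              unfolding \<delta>_def \<eta>_def
              by (rule diagonal_system_perturbation[OF low ex sol elim[unfolded \<eta>_def]])
            with True show ?thesis using lam1 by (simp add: \<epsilon>_def u_def field_simps)
          next
            case False
            then have "\<epsilon> N \<omega> = 0" by (auto simp: \<epsilon>_def)
            also have "0 \<le> u N" unfolding u_def using \<delta>0 \<eta>0 lam1
              by (intro mult_nonneg_nonneg add_nonneg_nonneg sum_nonneg) auto
            finally show ?thesis .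
          qed
        qed
      qed
    qed
    moreover have "L2_norm \<mu> (\<lambda>y. galerkin_approx M e (c N \<omega>) y - \<phi> y) \<le> 1 / lam M * L2_norm \<mu> h + \<epsilon> N \<omega>"
      if "1 \<le> N" "\<omega> \<in> S N" for N \<omega>
    proof -
      have lamM: "0 < lam M" using lam1 low[of M] M by auto
      have mean: "L2_inner \<mu> \<phi> (e 0) = 0" using phi_H1 by (simp add: L2_inner_def e0 H1_0_def)
      define T where "T = (L2_norm \<mu> \<phi>)\<^sup>2 - (\<Sum>m=1..M. (L2_inner \<mu> \<phi> (e m))\<^sup>2)"
      have T: "T \<le> (1 / lam M * L2_norm \<mu> h)\<^sup>2"
        unfolding T_def by (rule spectral_truncation_error[OF onb hL phiL coeff mean lamM lam_mono'])
      have "(L2_norm \<mu> (\<lambda>y. galerkin_approx M e (c N \<omega>) y - \<phi> y))\<^sup>2 = (\<Sum>m=1..M. (c N \<omega> m - x m)\<^sup>2) + T"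
        unfolding galerkin_approx_def x_def T_def
        by (rule orthonormal_best_approximation[OF eL phiL _ orth]) simp
      also have "\<dots> \<le> (\<Sum>m=1..M. \<bar>c N \<omega> m - x m\<bar>)\<^sup>2 + (1 / lam M * L2_norm \<mu> h)\<^sup>2"
      proof (intro add_mono T)
        have "(\<Sum>m=1..M. (c N \<omega> m - x m)\<^sup>2) = (L2_set (\<lambda>m. c N \<omega> m - x m) {1..M})\<^sup>2"
          by (simp add: L2_set_def sum_nonneg)
        also have "\<dots> \<le> (\<Sum>m=1..M. \<bar>c N \<omega> m - x m\<bar>)\<^sup>2"
          by (intro power_mono L2_set_le_sum_abs) simp
        finally show "(\<Sum>m=1..M. (c N \<omega> m - x m)\<^sup>2) \<le> (\<Sum>m=1..M. \<bar>c N \<omega> m - x m\<bar>)\<^sup>2" .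
      qed
      also have "(\<Sum>m=1..M. \<bar>c N \<omega> m - x m\<bar>) = \<epsilon> N \<omega>" using that by (simp add: \<epsilon>_def)
      also have "(\<epsilon> N \<omega>)\<^sup>2 + (1 / lam M * L2_norm \<mu> h)\<^sup>2 \<le> (1 / lam M * L2_norm \<mu> h + \<epsilon> N \<omega>)\<^sup>2"
        using lamM L2_norm_nonneg[of \<mu> h] by (simp add: power2_sum \<epsilon>_def sum_nonneg)
      finally show ?thesis
        by (rule power2_le_imp_le) (use lamM L2_norm_nonneg[of \<mu> h] in \<open>simp add: \<epsilon>_def sum_nonneg\<close>)
    qed
    ultimately show ?thesis by (intro exI[of _ \<epsilon>]) (auto simp: S_def)
  qed
  show ?thesis using prob_lim main unfolding S_def by blast
qed

end
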